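(* Fix integers $K\ge1$ and $1\le L\le \tilde L$, let $R=L/\tilde L$, and fix channel coefficients $h_1,\dots,h_K\in\mathbb{C}\setminus\{0\}$, constants $P_W,P_X,N_0>0$, and $\rho_X=P_X/N_0$. Consider the optimization problem of minimizing the expected computation error $\gamma=\mathbb{E}[d(\mathbf{w},\hat{\mathbf{w}})]$ over all pairs $(\boldsymbol{\Phi},P)$ with $P>0$ satisfying the power constraint $\frac{L P P_W}{\tilde L |h_k|^2}\le P_X$ for all $k$, and with $\boldsymbol{\Phi}\in\mathbb{C}^{\tilde L\times L}$ an admissible encoding matrix. Then: (i) A pair $(\boldsymbol{\Phi},P)$ is optimal if and only if $P=P^*:=\frac{P_X\min_k|h_k|^2}{R P_W}$ and $\boldsymbol{\Phi}$ is an admissible encoding matrix satisfying $\boldsymbol{\Phi}^{\mathsf H}\boldsymbol{\Phi}=\mathbf{I}_L$. (ii) The minimal expected computation error is $$\gamma_{\mathrm{opt}}=\frac{R P_W}{\rho_X\min_k|h_k|^2}.$$ (iii) Under any optimal pair, the distortion $d(\mathbf{w},\hat{\mathbf{w}})$ is Gamma distributed with shape parameter $L$ and scale parameter $\frac{P_W}{\tilde L\rho_X\min_k|h_k|^2}$, i.e. $d(\mathbf{w},\hat{\mathbf{w}})\sim\Gamma\!\left(L,\frac{P_W}{\tilde L\rho_X\min_k|h_k|^2}\right)$.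
   Context: System model (channel-coded over-the-air computation). There are $K$ users; user $k$ holds a random source message $\mathbf{w}_k\in\mathbb{C}^L$, with $\mathbf{w}_1,\dots,\mathbf{w}_K$ independent and $\mathbf{w}_k\sim\mathcal{CN}(\mathbf{0},P_W\mathbf{I}_L)$. The target is $\mathbf{w}=\sum_{k=1}^K\mathbf{w}_k$. An admissible encoding matrix is $\boldsymbol{\Phi}\in\mathbb{C}^{\tilde L\times L}$ with $\tilde L\ge L$ such that (a) $\mathrm{tr}(\boldsymbol{\Phi}^{\mathsf H}\boldsymbol{\Phi})=L$ and (b) for every subset $\mathcal{S}\subseteq\{1,\dots,\tilde L\}$ with $|\mathcal{S}|=L$, the $L\times L$ submatrix of rows of $\boldsymbol{\Phi}$ indexed by $\mathcal{S}$ has rank $L$. The coding rate is $R=L/\tilde L$. All users use the same $\boldsymbol{\Phi}$; user $k$ transmits $\mathbf{x}_k=\frac{\sqrt{P}}{h_k}\boldsymbol{\Phi}\mathbf{w}_k$ with common power scaling $P>0$ and nonzero channel coefficient $h_k\in\mathbb{C}$. The base station receives $\mathbf{y}=\sum_k h_k\mathbf{x}_k+\mathbf{n}=\sqrt{P}\,\boldsymbol{\Phi}\mathbf{w}+\mathbf{n}$, where $\mathbf{n}\sim\mathcal{CN}(\mathbf{0},N_0\mathbf{I}_{\tilde L})$ is independent of the messages, and estimates $\hat{\mathbf{w}}=\boldsymbol{\Phi}^{\dagger}\mathbf{y}/\sqrt{P}$ ($\dagger$ = Moore–Penrose pseudoinverse). The power constraint is $\frac{1}{\tilde L}\mathbb{E}\|\mathbf{x}_k\|^2=\frac{LPP_W}{\tilde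 L|h_k|^2}\le P_X$ for all $k$. The distortion is $d(\mathbf{w},\hat{\mathbf{w}})=\frac1L\|\hat{\mathbf{w}}-\mathbf{w}\|^2$ and the computation error is $\gamma=\mathbb{E}[d(\mathbf{w},\hat{\mathbf{w}})]$. $\Gamma(\alpha,\theta)$ denotes the Gamma distribution with shape $\alpha$ and scale $\theta$. *)

theory Defs
  imports "HOL-Probability.Probability"
          "Jordan_Normal_Form.Schur_Decomposition"
          "Jordan_Normal_Form.DL_Rank"
          "Jordan_Normal_Form.DL_Submatrix"
begin

definition mat_tr :: "complex mat \<Rightarrow> complex" where
  "mat_tr A = (\<Sum>i<dim_row A. A $$ (i, i))"

definition is_mp_pinv :: "complex mat \<Rightarrow> complex mat \<Rightarrow> bool" where
  "is_mp_pinv A X \<longleftrightarrow> X \<in> carrier_mat (dim_col A) (dim_row A) \<and>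
     A * X * A = A \<and> X * A * X = X \<and>
     mat_adjoint (A * X) = A * X \<and> mat_adjoint (X * A) = X * A"

definition mp_pinv :: "complex mat \<Rightarrow> complex mat" where
  "mp_pinv A = (THE X. is_mp_pinv A X)"

definition admissible_enc :: "nat \<Rightarrow> nat \<Rightarrow> complex mat \<Rightarrow> bool" where
  "admissible_enc L Lt \<Phi> \<longleftrightarrow> \<Phi> \<in> carrier_mat Lt L \<and>
     mat_tr (mat_adjoint \<Phi> * \<Phi>) = of_nat L \<and>
     (\<forall>S. S \<subseteq> {..<Lt} \<longrightarrow> card S = L \<longrightarrow>
          vec_space.rank L (submatrix \<Phi> S UNIV) = L)"

(* Circularly-symmetric complex Gaussian vector CN(0, s2 I_n):
   the 2n real random variables Re X_i, Im X_i (i < n) are independent, each N(0, s2/2) *)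
definition cn_vec :: "'w measure \<Rightarrow> nat \<Rightarrow> real \<Rightarrow> ('w \<Rightarrow> nat \<Rightarrow> complex) \<Rightarrow> bool" where
  "cn_vec M n s2 X \<longleftrightarrow>
     prob_space.indep_vars M (\<lambda>_. borel)
       (\<lambda>(i, b) \<omega>. if b then Re (X \<omega> i) else Im (X \<omega> i)) ({..<n} \<times> UNIV) \<and>
     (\<forall>i<n. distributed M lborel (\<lambda>\<omega>. Re (X \<omega> i)) (\<lambda>x. ennreal (normal_density 0 (sqrt (s2 / 2)) x)) \<and>
            distributed M lborel (\<lambda>\<omega>. Im (X \<omega> i)) (\<lambda>x. ennreal (normal_density 0 (sqrt (s2 / 2)) x)))"

(* Stochastic model: messages w_0..w_{K-1} ~ CN(0, PW I_L), noise n ~ CN(0, N0 I_Lt),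
   all K+1 random vectors mutually independent (None indexes the noise). *)
definition ota_model :: "'w measure \<Rightarrow> nat \<Rightarrow> nat \<Rightarrow> nat \<Rightarrow> real \<Rightarrow> real \<Rightarrow>
    (nat \<Rightarrow> 'w \<Rightarrow> nat \<Rightarrow> complex) \<Rightarrow> ('w \<Rightarrow> nat \<Rightarrow> complex) \<Rightarrow> bool" where
  "ota_model M K L Lt PW N0 w nz \<longleftrightarrow>
     prob_space M \<and>
     (\<forall>k<K. cn_vec M L PW (w k)) \<and> cn_vec M Lt N0 nz \<and>
     prob_space.indep_vars M
       (\<lambda>j. PiM {..<case_option Lt (\<lambda>_. L) j} (\<lambda>_. (borel :: complex measure)))
       (\<lambda>j \<omega>. restrict (case_option nz (\<lambda>k. w k) j \<omega>) {..<case_option Lt (\<lambda>_. L) j})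
       (insert None (Some ` {..<K}))"

definition msg_vec :: "nat \<Rightarrow> (nat \<Rightarrow> 'w \<Rightarrow> nat \<Rightarrow> complex) \<Rightarrow> nat \<Rightarrow> 'w \<Rightarrow> complex vec" where
  "msg_vec L w k \<omega> = vec L (w k \<omega>)"

definition target_vec :: "nat \<Rightarrow> nat \<Rightarrow> (nat \<Rightarrow> 'w \<Rightarrow> nat \<Rightarrow> complex) \<Rightarrow> 'w \<Rightarrow> complex vec" where
  "target_vec K L w \<omega> = vec L (\<lambda>i. \<Sum>k<K. w k \<omega> i)"

definition tx_vec :: "nat \<Rightarrow> (nat \<Rightarrow> complex) \<Rightarrow> (nat \<Rightarrow> 'w \<Rightarrow> nat \<Rightarrow> complex) \<Rightarrow>
    complex mat \<Rightarrow> real \<Rightarrow> nat \<Rightarrow> 'w \<Rightarrow> complex vec" where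
  "tx_vec L h w \<Phi> P k \<omega> = (complex_of_real (sqrt P) / h k) \<cdot>\<^sub>v (\<Phi> *\<^sub>v msg_vec L w k \<omega>)"

definition rx_vec :: "nat \<Rightarrow> nat \<Rightarrow> nat \<Rightarrow> (nat \<Rightarrow> complex) \<Rightarrow> (nat \<Rightarrow> 'w \<Rightarrow> nat \<Rightarrow> complex) \<Rightarrow>
    ('w \<Rightarrow> nat \<Rightarrow> complex) \<Rightarrow> complex mat \<Rightarrow> real \<Rightarrow> 'w \<Rightarrow> complex vec" where
  "rx_vec K L Lt h w nz \<Phi> P \<omega> =
     vec Lt (\<lambda>i. (\<Sum>k<K. h k * (tx_vec L h w \<Phi> P k \<omega> $ i)) + nz \<omega> i)"

definition est_vec :: "nat \<Rightarrow> nat \<Rightarrow> nat \<Rightarrow> (nat \<Rightarrow> complex) \<Rightarrow> (nat \<Rightarrow> 'w \<Rightarrow> nat \<Rightarrow> complex) \<Rightarrow>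
    ('w \<Rightarrow> nat \<Rightarrow> complex) \<Rightarrow> complex mat \<Rightarrow> real \<Rightarrow> 'w \<Rightarrow> complex vec" where
  "est_vec K L Lt h w nz \<Phi> P \<omega> =
     (1 / complex_of_real (sqrt P)) \<cdot>\<^sub>v (mp_pinv \<Phi> *\<^sub>v rx_vec K L Lt h w nz \<Phi> P \<omega>)"

definition distortion :: "nat \<Rightarrow> complex vec \<Rightarrow> complex vec \<Rightarrow> real" where
  "distortion L u v = (\<Sum>i<L. (cmod (v $ i - u $ i))\<^sup>2) / real L"

definition ota_dist :: "nat \<Rightarrow> nat \<Rightarrow> nat \<Rightarrow> (nat \<Rightarrow> complex) \<Rightarrow> (nat \<Rightarrow> 'w \<Rightarrow> nat \<Rightarrow> complex) \<Rightarrow>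
    ('w \<Rightarrow> nat \<Rightarrow> complex) \<Rightarrow> complex mat \<Rightarrow> real \<Rightarrow> 'w \<Rightarrow> real" where
  "ota_dist K L Lt h w nz \<Phi> P \<omega> =
     distortion L (target_vec K L w \<omega>) (est_vec K L Lt h w nz \<Phi> P \<omega>)"

definition comp_error :: "'w measure \<Rightarrow> nat \<Rightarrow> nat \<Rightarrow> nat \<Rightarrow> (nat \<Rightarrow> complex) \<Rightarrow>
    (nat \<Rightarrow> 'w \<Rightarrow> nat \<Rightarrow> complex) \<Rightarrow> ('w \<Rightarrow> nat \<Rightarrow> complex) \<Rightarrow> complex mat \<Rightarrow> real \<Rightarrow> real" where
  "comp_error M K L Lt h w nz \<Phi> P = (\<integral>\<omega>. ota_dist K L Lt h w nz \<Phi> P \<omega> \<partial>M)"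

definition feasible :: "nat \<Rightarrow> nat \<Rightarrow> nat \<Rightarrow> (nat \<Rightarrow> complex) \<Rightarrow> real \<Rightarrow> real \<Rightarrow>
    complex mat \<Rightarrow> real \<Rightarrow> bool" where
  "feasible K L Lt h PW PX \<Phi> P \<longleftrightarrow> P > 0 \<and> admissible_enc L Lt \<Phi> \<and>
     (\<forall>k<K. real L * P * PW / (real Lt * (cmod (h k))\<^sup>2) \<le> PX)"

definition optimal :: "'w measure \<Rightarrow> nat \<Rightarrow> nat \<Rightarrow> nat \<Rightarrow> (nat \<Rightarrow> complex) \<Rightarrow> real \<Rightarrow> real \<Rightarrow>
    (nat \<Rightarrow> 'w \<Rightarrow> nat \<Rightarrow> complex) \<Rightarrow> ('w \<Rightarrow> nat \<Rightarrow> complex) \<Rightarrow> complex mat \<Rightarrow> real \<Rightarrow> bool" where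
  "optimal M K L Lt h PW PX w nz \<Phi> P \<longleftrightarrow> feasible K L Lt h PW PX \<Phi> P \<and>
     (\<forall>\<Phi>' P'. feasible K L Lt h PW PX \<Phi>' P' \<longrightarrow>
        comp_error M K L Lt h w nz \<Phi> P \<le> comp_error M K L Lt h w nz \<Phi>' P')"

definition gamma_density :: "real \<Rightarrow> real \<Rightarrow> real \<Rightarrow> real" where
  "gamma_density a th x = (if x > 0 then x powr (a - 1) * exp (- x / th) / (Gamma a * th powr a) else 0)"

end

theory Submission
  imports Defs
begin

text \<open>Write \<open>X\<close> for the pseudoinverse of \<open>\<Phi>\<close>. Admissibility makes \<open>\<Phi>\<close> injective, so
  \<open>X * \<Phi> = 1\<close>, the messages cancel and the distortion is \<open>|X n|^2 / (L * P)\<close>, with mean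
  \<open>N0 * |X|^2 / (L * P)\<close> in the Frobenius norm. Since \<open>tr (X * \<Phi>) = L = tr (\<Phi>^H * \<Phi>)\<close>, one has
  \<open>|X - \<Phi>^H|^2 = |X|^2 - L\<close>; hence \<open>|X|^2 \<ge> L\<close>, with equality iff \<open>X = \<Phi>^H\<close>, i.e. iff
  \<open>\<Phi>^H * \<Phi> = 1\<close>. Partial DFT matrices (whose row submatrices are Vandermonde) attain the bound.
  For such \<open>\<Phi>\<close> the law of \<open>|\<Phi>^H n|^2\<close> is identified through its Laplace transform at
  the natural numbers.\<close>

section \<open>Squared norms of Gaussian vectors\<close>

text \<open>Independence factors the characteristic function over \<open>J\<close>. The result
  depends on \<open>a\<close> only through its Euclidean norm, and this rotation invariance is what
  the later distributional argument rests on.\<close>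

lemma (in prob_space) expectation_iexp_indep_normal:
  assumes J: "finite J" and ind: "indep_vars (\<lambda>_. borel) X J" and s: "s > 0"
    and X: "\<And>j. j \<in> J \<Longrightarrow> distributed M lborel (X j) (\<lambda>x. ennreal (normal_density 0 s x))"
  shows "expectation (\<lambda>\<omega>. iexp (\<Sum>j\<in>J. a j * X j \<omega>)) =
    complex_of_real (exp (- (s\<^sup>2 * (\<Sum>j\<in>J. (a j)\<^sup>2)) / 2))"
proof -
  have single: "expectation (\<lambda>\<omega>. iexp (a j * X j \<omega>)) = complex_of_real (exp (- (s\<^sup>2 * (a j)\<^sup>2) / 2))"
    if j: "j \<in> J" for j
  proof -
    have D: "distributed M lborel (\<lambda>\<omega>. (X j \<omega> - 0) / s) std_normal_density"
      using X[OF j] normal_standard_normal_convert[OF s, of "X j" 0] by simp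
    have [measurable]: "(\<lambda>\<omega>. X j \<omega> / s) \<in> borel_measurable M"
      using distributed_measurable[OF D] by simp
    have "distr M borel (\<lambda>\<omega>. X j \<omega> / s) = std_normal_distribution"
      using distributed_distr_eq_density[OF D] by (simp cong: distr_cong)
    then have "complex_of_real (exp (- ((a j * s)^2) / 2)) = char (distr M borel (\<lambda>\<omega>. X j \<omega> / s)) (a j * s)"
      by (simp add: char_std_normal_distribution)
    also have "\<dots> = expectation (\<lambda>\<omega>. iexp ((a j * s) * (X j \<omega> / s)))"
      unfolding char_def by (subst integral_distr) auto
    also have "\<dots> = expectation (\<lambda>\<omega>. iexp (a j * X j \<omega>))"
      using s by simp
    finally show ?thesis by (simp add: power_mult_distrib mult.commute)
  qed
  have ind': "indep_vars (\<lambda>_. borel) (\<lambda>j \<omega>. iexp (a j * X j \<omega>)) J"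
    by (rule indep_vars_compose2[OF ind, where Y="\<lambda>j x. iexp (a j * x)"]) auto
  have rv[measurable]: "X j \<in> borel_measurable M" if "j \<in> J" for j
    using ind that by (auto simp: indep_vars_def)
  have "expectation (\<lambda>\<omega>. iexp (\<Sum>j\<in>J. a j * X j \<omega>)) = expectation (\<lambda>\<omega>. \<Prod>j\<in>J. iexp (a j * X j \<omega>))"
    by (simp add: sum_distrib_left exp_sum J)
  also have "\<dots> = (\<Prod>j\<in>J. expectation (\<lambda>\<omega>. iexp (a j * X j \<omega>)))"
    by (rule indep_vars_lebesgue_integral[OF J ind'])
       (auto intro!: integrable_const_bound[where B=1])
  also have "\<dots> = (\<Prod>j\<in>J. complex_of_real (exp (- (s\<^sup>2 * (a j)\<^sup>2) / 2)))"
    by (intro prod.cong refl single)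
  also have "\<dots> = complex_of_real (exp (\<Sum>j\<in>J. - (s\<^sup>2 * (a j)\<^sup>2) / 2))"
    by (simp add: exp_sum J)
  also have "(\<Sum>j\<in>J. - (s\<^sup>2 * (a j)\<^sup>2) / 2) = - (s\<^sup>2 * (\<Sum>j\<in>J. (a j)\<^sup>2)) / 2"
    by (simp add: sum_distrib_left sum_negf sum_divide_distrib)
  finally show ?thesis .
qed

text \<open>A linear combination of independent centred normals is again centred normal, so its
  second moment is the sum of the variances. The form \<open>has_bochner_integral\<close> supplies
  integrability together with the value.\<close>

lemma (in prob_space) second_moment_indep_normal:
  assumes J: "finite J" and ind: "indep_vars (\<lambda>_. borel) X J" and s: "s > 0"
    and X: "\<And>j. j \<in> J \<Longrightarrow> distributed M lborel (X j) (\<lambda>x. ennreal (normal_density 0 s x))"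
  shows "has_bochner_integral M (\<lambda>\<omega>. (\<Sum>j\<in>J. a j * X j \<omega>)\<^sup>2) (s\<^sup>2 * (\<Sum>j\<in>J. (a j)\<^sup>2))"
proof -
  \<comment> \<open>Zero coefficients are dropped because \<open>sum_indep_normal\<close> asks for
    positive standard deviations and a nonempty index set; the case where nothing remains is treated
    separately.\<close>
  define J' where "J' = {j\<in>J. a j \<noteq> 0}"
  have J': "J' \<subseteq> J" "finite J'" using J by (auto simp: J'_def)
  \<comment> \<open>The summand \<open>0\<close> gives each term the affine shape that
    \<open>normal_density_affine\<close> expects.\<close>
  have S: "(\<Sum>j\<in>J. a j * X j \<omega>) = (\<Sum>j\<in>J'. 0 + a j * X j \<omega>)" for \<omega>
    using J by (intro sum.mono_neutral_cong_right) (auto simp: J'_def)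
  have T: "(\<Sum>j\<in>J. (a j)\<^sup>2) = (\<Sum>j\<in>J'. (a j)\<^sup>2)"
    using J by (intro sum.mono_neutral_cong_right) (auto simp: J'_def)
  show ?thesis
  proof (cases "J' = {}")
    case True
    then show ?thesis unfolding S T by (simp add: has_bochner_integral_iff)
  next
    case False
    have ind': "indep_vars (\<lambda>_. borel) (\<lambda>j \<omega>. 0 + a j * X j \<omega>) J'"
      by (rule indep_vars_compose2[OF indep_vars_subset[OF ind J'(1)], where Y="\<lambda>j x. 0 + a j * x"]) auto
    have "distributed M lborel (\<lambda>\<omega>. \<Sum>j\<in>J'. 0 + a j * X j \<omega>)
      (normal_density (\<Sum>j\<in>J'. 0 + a j * 0) (sqrt (\<Sum>j\<in>J'. (\<bar>a j\<bar> * s)\<^sup>2)))"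
    proof (rule sum_indep_normal[OF J'(2) False ind'])
      fix j assume j: "j \<in> J'"
      then show "0 < \<bar>a j\<bar> * s" using s by (auto simp: J'_def)
      show "distributed M lborel (\<lambda>\<omega>. 0 + a j * X j \<omega>) (normal_density (0 + a j * 0) (\<bar>a j\<bar> * s))"
        using j J' X s by (intro normal_density_affine) (auto simp: J'_def)
    qed
    also have "(\<Sum>j\<in>J'. (\<bar>a j\<bar> * s)\<^sup>2) = s\<^sup>2 * (\<Sum>j\<in>J'. (a j)\<^sup>2)"
      by (simp add: sum_distrib_left power_mult_distrib mult.commute)
    finally have D: "distributed M lborel (\<lambda>\<omega>. \<Sum>j\<in>J'. 0 + a j * X j \<omega>)
      (normal_density 0 (sqrt (s\<^sup>2 * (\<Sum>j\<in>J'. (a j)\<^sup>2))))" (is "distributed _ _ ?S (normal_density 0 ?\<sigma>)")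
      by simp
    \<comment> \<open>The even moment formula at \<open>k = 1\<close>; its value
      \<open>2 / (2 / ?\<sigma>^2)\<close> is the variance.\<close>
    have m: "has_bochner_integral lborel (\<lambda>x. normal_density 0 ?\<sigma> x * (x - 0) ^ (2 * 1))
        (fact (2 * 1) / ((2 / ?\<sigma>\<^sup>2)^1 * fact 1))"
      by (rule normal_moment_even) (use False s J' in \<open>auto intro!: mult_pos_pos sum_pos simp: J'_def\<close>)
    have sq: "?\<sigma>\<^sup>2 = s\<^sup>2 * (\<Sum>j\<in>J'. (a j)\<^sup>2)"
      by (simp add: sum_nonneg)
    have "integrable M (\<lambda>\<omega>. (?S \<omega>)\<^sup>2)" "expectation (\<lambda>\<omega>. (?S \<omega>)\<^sup>2) = s\<^sup>2 * (\<Sum>j\<in>J'. (a j)\<^sup>2)"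
      using distributed_integrable[OF D, of "\<lambda>x. x\<^sup>2"] distributed_integral[OF D, of "\<lambda>x. x\<^sup>2"] m
      unfolding sq by (simp_all add: has_bochner_integral_iff)
    then show ?thesis unfolding S T by (simp add: has_bochner_integral_iff)
  qed
qed

text \<open>The factor \<open>exp (- t * x^2)\<close> only narrows the Gaussian: the product is a
  multiple of another centred normal density, and that multiple is the integral.\<close>

lemma integral_exp_square_std_normal:
  assumes "t \<ge> 0"
  shows "integrable std_normal_distribution (\<lambda>x. exp (- t * x\<^sup>2))"
    and "(\<integral>x. exp (- t * x\<^sup>2) \<partial>std_normal_distribution) = 1 / sqrt (1 + 2 * t)"
proof -
  interpret real_distribution std_normal_distribution by (rule real_dist_normal_dist)
  show "integrable std_normal_distribution (\<lambda>x. exp (- t * x\<^sup>2))"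
    using assms by (intro integrable_const_bound[where B=1]) auto
  \<comment> \<open>Adding the exponents \<open>x^2 / 2\<close> and \<open>t * x^2\<close> gives
    \<open>(1 + 2 * t) * x^2 / 2\<close>, so the new variance is \<open>1 / (1 + 2 * t)\<close>. The
    normalising constants leave exactly the factor \<open>\<sigma>\<close>.\<close>
  define \<sigma> where "\<sigma> = 1 / sqrt (1 + 2 * t)"
  have \<sigma>: "\<sigma> > 0" "\<sigma>\<^sup>2 = 1 / (1 + 2 * t)" using assms by (auto simp: \<sigma>_def power_divide)
  have eq: "std_normal_density x * exp (- (t * x\<^sup>2)) = \<sigma> * normal_density 0 \<sigma> x" for x
  proof -
    have e: "- x\<^sup>2 / 2 + - t * x\<^sup>2 = - (x - 0)\<^sup>2 / (2 * \<sigma>\<^sup>2)"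
      unfolding \<sigma>(2) using assms by (simp add: field_simps)
    have "std_normal_density x * exp (- (t * x\<^sup>2)) = 1 / sqrt (2 * pi) * exp (- x\<^sup>2 / 2 + - t * x\<^sup>2)"
      unfolding std_normal_density_def exp_add by simp
    also have "\<dots> = \<sigma> * normal_density 0 \<sigma> x"
      unfolding e normal_density_def using \<sigma>(1) by (simp add: real_sqrt_mult)
    finally show ?thesis .
  qed
  have "(\<integral>x. exp (- t * x\<^sup>2) \<partial>std_normal_distribution) = (\<integral>x. \<sigma> * normal_density 0 \<sigma> x \<partial>lborel)"
    by (subst integral_density) (auto simp: eq intro!: Bochner_Integration.integral_cong)
  also have "\<dots> = \<sigma>" using \<sigma> by simp
  finally show "(\<integral>x. exp (- t * x\<^sup>2) \<partial>std_normal_distribution) = 1 / sqrt (1 + 2 * t)"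
    by (simp add: \<sigma>_def)
qed

lemma integral_exp_sum_squares_PiM_std_normal:
  assumes "finite I" "t \<ge> 0"
  shows "(\<integral>g. exp (- t * (\<Sum>i\<in>I. (g i)\<^sup>2)) \<partial>PiM I (\<lambda>_. std_normal_distribution)) =
    (1 / sqrt (1 + 2 * t)) ^ card I"
proof -
  interpret N: real_distribution std_normal_distribution by (rule real_dist_normal_dist)
  interpret product_sigma_finite "\<lambda>_. std_normal_distribution"
    by standard
  have "(\<integral>g. exp (- t * (\<Sum>i\<in>I. (g i)\<^sup>2)) \<partial>PiM I (\<lambda>_. std_normal_distribution)) =
    (\<integral>g. (\<Prod>i\<in>I. exp (- t * (g i)\<^sup>2)) \<partial>PiM I (\<lambda>_. std_normal_distribution))"
    using assms by (simp add: exp_sum[symmetric] sum_distrib_left sum_negf)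
  also have "\<dots> = (\<Prod>i\<in>I. \<integral>x. exp (- t * x\<^sup>2) \<partial>std_normal_distribution)"
    using assms integral_exp_square_std_normal(1) by (intro product_integral_prod) auto
  also have "\<dots> = (1 / sqrt (1 + 2 * t)) ^ card I"
    using integral_exp_square_std_normal(2)[OF assms(2)] by simp
  finally show ?thesis .
qed

text \<open>To be read from right to left: it writes a Gaussian function of the vector
  \<open>a\<close> as an average of characters, which are easier to integrate because they are
  exponentials of linear forms.\<close>

lemma integral_iexp_PiM_std_normal:
  assumes "finite I"
  shows "(\<integral>g. iexp (\<Sum>i\<in>I. a i * g i) \<partial>PiM I (\<lambda>_. std_normal_distribution)) =
    complex_of_real (exp (- (\<Sum>i\<in>I. (a i)\<^sup>2) / 2))"
proof -
  interpret N: real_distribution std_normal_distribution by (rule real_dist_normal_dist)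
  interpret product_sigma_finite "\<lambda>_. std_normal_distribution"
    by standard
  have "(\<integral>g. iexp (\<Sum>i\<in>I. a i * g i) \<partial>PiM I (\<lambda>_. std_normal_distribution)) =
    (\<integral>g. (\<Prod>i\<in>I. iexp (a i * g i)) \<partial>PiM I (\<lambda>_. std_normal_distribution))"
    using assms by (simp add: exp_sum sum_distrib_left)
  also have "\<dots> = (\<Prod>i\<in>I. \<integral>x. iexp (a i * x) \<partial>std_normal_distribution)"
    using assms by (intro product_integral_prod N.integrable_const_bound[where B=1]) auto
  also have "\<dots> = (\<Prod>i\<in>I. complex_of_real (exp (- (a i)\<^sup>2 / 2)))"
    using char_std_normal_distribution[unfolded char_def fun_eq_iff] by simp
  also have "\<dots> = complex_of_real (exp (\<Sum>i\<in>I. - (a i)\<^sup>2 / 2))"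
    by (simp add: exp_sum assms)
  also have "(\<Sum>i\<in>I. - (a i)\<^sup>2 / 2) = - (\<Sum>i\<in>I. (a i)\<^sup>2) / 2"
    by (simp add: sum_negf sum_divide_distrib)
  finally show ?thesis .
qed

text \<open>Averaging over an auxiliary Gaussian \<open>g\<close> turns \<open>exp (- t |Y|^2)\<close> into the characters
  \<open>iexp (sqrt (2 t) <g, Y>)\<close>; after exchanging the integrals only the squared norm of the
  transposed image of \<open>g\<close> matters, which is \<open>|g|^2\<close> by hypothesis.\<close>

lemma (in prob_space) expectation_exp_norm_isometric_normal:
  fixes B :: "'i \<Rightarrow> 'j \<Rightarrow> real"
  assumes I: "finite I" and J: "finite J" and ind: "indep_vars (\<lambda>_. borel) X J" and s: "s > 0"
    and X: "\<And>j. j \<in> J \<Longrightarrow> distributed M lborel (X j) (\<lambda>x. ennreal (normal_density 0 s x))"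
    and iso: "\<And>g. (\<Sum>j\<in>J. (\<Sum>i\<in>I. g i * B i j)\<^sup>2) = (\<Sum>i\<in>I. (g i)\<^sup>2)"
    and t: "t \<ge> 0"
  shows "expectation (\<lambda>\<omega>. exp (- t * (\<Sum>i\<in>I. (\<Sum>j\<in>J. B i j * X j \<omega>)\<^sup>2))) =
    (1 / sqrt (1 + 2 * (s\<^sup>2 * t))) ^ card I"
proof -
  \<comment> \<open>Chosen so that \<open>exp (- c^2 * |Y|^2 / 2)\<close> is
    \<open>exp (- t * |Y|^2)\<close>.\<close>
  define c where "c = sqrt (2 * t)"
  have c: "c\<^sup>2 = 2 * t" using t by (simp add: c_def)
  define Y where "Y i \<omega> = (\<Sum>j\<in>J. B i j * X j \<omega>)" for i \<omega>
  define G where "G = PiM I (\<lambda>_. std_normal_distribution)"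
  interpret N: real_distribution std_normal_distribution by (rule real_dist_normal_dist)
    interpret G: prob_space G unfolding G_def by (intro prob_space_PiM N.prob_space_axioms)
  interpret MG: pair_prob_space M G ..
  have rv[measurable]: "X j \<in> borel_measurable M" if "j \<in> J" for j
    using ind that by (auto simp: indep_vars_def)
  have Ym[measurable]: "Y i \<in> borel_measurable M" for i
    unfolding Y_def by (intro borel_measurable_sum borel_measurable_times borel_measurable_const rv)
  have Gm[measurable]: "(\<lambda>g. g i) \<in> borel_measurable G" if "i \<in> I" for i
    using measurable_component_singleton[OF that, of "\<lambda>_. std_normal_distribution"] unfolding G_def by simp
  \<comment> \<open>The pairing of \<open>g\<close> with \<open>B X\<close> is moved to a pairing of
    the transposed image of \<open>g\<close> with \<open>X\<close>.\<close>
  have ex: "(\<Sum>i\<in>I. (c * Y i \<omega>) * g i) = (\<Sum>j\<in>J. (c * (\<Sum>i\<in>I. g i * B i j)) * X j \<omega>)" for \<omega> g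
    unfolding Y_def sum_distrib_left sum_distrib_right
    by (subst sum.swap) (simp add: mult_ac)
  have inner: "expectation (\<lambda>\<omega>. iexp (\<Sum>i\<in>I. (c * Y i \<omega>) * g i)) =
      complex_of_real (exp (- (s\<^sup>2 * t) * (\<Sum>i\<in>I. (g i)\<^sup>2)))" for g
  proof -
    have "- (s\<^sup>2 * (\<Sum>j\<in>J. (c * (\<Sum>i\<in>I. g i * B i j))\<^sup>2)) / 2 = - (s\<^sup>2 * t) * (\<Sum>i\<in>I. (g i)\<^sup>2)"
      by (simp add: power_mult_distrib c iso flip: sum_distrib_left)
    then show ?thesis
      unfolding ex using expectation_iexp_indep_normal[OF J ind s X, of "\<lambda>j. c * (\<Sum>i\<in>I. g i * B i j)"]
      by simp
  qed
  have "complex_of_real (expectation (\<lambda>\<omega>. exp (- t * (\<Sum>i\<in>I. (Y i \<omega>)\<^sup>2)))) =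
      expectation (\<lambda>\<omega>. complex_of_real (exp (- t * (\<Sum>i\<in>I. (Y i \<omega>)\<^sup>2))))"
    by simp
  also have "\<dots> = expectation (\<lambda>\<omega>. \<integral>g. iexp (\<Sum>i\<in>I. (c * Y i \<omega>) * g i) \<partial>G)"
    unfolding G_def integral_iexp_PiM_std_normal[OF I]
    by (simp add: power_mult_distrib c sum_distrib_left[symmetric])
  also have "\<dots> = (\<integral>g. expectation (\<lambda>\<omega>. iexp (\<Sum>i\<in>I. (c * Y i \<omega>) * g i)) \<partial>G)"
    \<comment> \<open>The integrand has modulus 1 on a product of probability spaces, hence is
      integrable there.\<close>
    by (rule MG.Fubini_integral[symmetric], rule MG.P.integrable_const_bound[where B=1]) auto
  also have "\<dots> = (\<integral>g. complex_of_real (exp (- (s\<^sup>2 * t) * (\<Sum>i\<in>I. (g i)\<^sup>2))) \<partial>G)"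
    by (simp only: inner)
  also have "\<dots> = complex_of_real ((1 / sqrt (1 + 2 * (s\<^sup>2 * t))) ^ card I)"
    unfolding G_def integral_complex_of_real
    using integral_exp_sum_squares_PiM_std_normal[OF I, of "s\<^sup>2 * t"] t by simp
  finally show ?thesis unfolding Y_def of_real_eq_iff .
qed

text \<open>The map \<open>x \<mapsto> exp (- x)\<close> sends both measures to measures on \<open>{0..1}\<close>, where the characteristic
  function is a power series in the moments, i.e. in the given values of the Laplace transform.\<close>

lemma Laplace_nat_unique:
  fixes M N :: "real measure"
  assumes "real_distribution M" "real_distribution N"
    and "AE x in M. 0 \<le> x" "AE x in N. 0 \<le> x"
    and eq: "\<And>n::nat. (\<integral>x. exp (- real n * x) \<partial>M) = (\<integral>x. exp (- real n * x) \<partial>N)"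
  shows "M = N"
proof -
  define E :: "real \<Rightarrow> real" where "E x = exp (- x)" for x
  have [measurable]: "E \<in> borel_measurable borel" unfolding E_def by measurable
  have key: "char (distr A borel E) u = (\<Sum>n. (\<i> * u) ^ n / fact n * complex_of_real (\<integral>x. exp (- real n * x) \<partial>A))"
    if A: "real_distribution A" and ae: "AE x in A. 0 \<le> x" for A u
  proof -
    interpret A: real_distribution A by fact
    let ?f = "\<lambda>n x. (\<i> * complex_of_real u) ^ n / fact n * complex_of_real (exp (- real n * x))"
    have nf: "norm (?f n x) = \<bar>u\<bar> ^ n / fact n * exp (- real n * x)" for n x
      by (simp add: norm_mult norm_power norm_divide)
    have int: "integrable A (\<lambda>x. exp (- real n * x))" for n
      using ae by (intro A.integrable_const_bound[where B=1]) (auto simp: eventually_mono)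
    \<comment> \<open>Since \<open>E x ^ n = exp (- n * x)\<close>, the term \<open>?f n x\<close>
      is the \<open>n\<close>-th term of the exponential series for
      \<open>iexp (u * E x)\<close>.\<close>
    have fE: "?f n x = (\<i> * complex_of_real (u * E x)) ^ n /\<^sub>R fact n" for n x
      by (simp add: E_def power_mult_distrib exp_of_nat_mult[symmetric] scaleR_conv_of_real
          field_simps flip: of_real_power)
    have "char (distr A borel E) u = (\<integral>x. iexp (u * E x) \<partial>A)"
      unfolding char_def by (subst integral_distr) auto
    also have "\<dots> = (\<integral>x. (\<Sum>n. ?f n x) \<partial>A)"
      by (simp only: fE) (simp only: exp_def)
    \<comment> \<open>Sum and integral may be exchanged because \<open>exp (- n * x) \<le> 1\<close>
      almost everywhere, so the integrated norms are dominated by the exponential series of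
      \<open>\<bar>u\<bar>\<close>.\<close>
    also have "\<dots> = (\<Sum>n. integral\<^sup>L A (?f n))"
    proof (rule integral_suminf)
      show "integrable A (?f n)" for n
        using int[of n] by (intro integrable_mult_right integrable_of_real)
      show "AE x in A. summable (\<lambda>n. norm (?f n x))"
        unfolding fE by (intro always_eventually allI summable_norm_exp)
      show "summable (\<lambda>n. \<integral>x. norm (?f n x) \<partial>A)"
      proof (rule summable_comparison_test'[where N=0])
        show "summable (\<lambda>n. \<bar>u\<bar> ^ n / fact n)"
          using summable_exp_generic[of "\<bar>u\<bar>"] by (simp add: field_simps)
        fix n
        have "(\<integral>x. exp (- real n * x) \<partial>A) \<le> (\<integral>x. 1 \<partial>A)"
          using ae int[of n] by (intro integral_mono_AE) (auto elim!: eventually_mono)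
        then have "(\<integral>x. exp (- real n * x) \<partial>A) \<le> 1" using A.prob_space by simp
        then show "norm (\<integral>x. norm (?f n x) \<partial>A) \<le> \<bar>u\<bar> ^ n / fact n"
          unfolding nf by (simp add: abs_mult mult_left_le divide_right_mono)
      qed
    qed
    also have "\<dots> = (\<Sum>n. (\<i> * u) ^ n / fact n * complex_of_real (\<integral>x. exp (- real n * x) \<partial>A))"
      by (simp only: integral_mult_right_zero integral_complex_of_real)
    finally show ?thesis .
  qed
  interpret M: real_distribution M by fact
  interpret N: real_distribution N by fact
  have "distr M borel E = distr N borel E"
    using assms by (intro Levy_uniqueness M.real_distribution_distr N.real_distribution_distr ext)
      (simp_all add: key)
  \<comment> \<open>The substitution is undone by the inverse \<open>- ln y\<close> of
    \<open>E\<close>.\<close>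
  then have "distr (distr M borel E) borel (\<lambda>y. - ln y) = distr (distr N borel E) borel (\<lambda>y. - ln y)"
    by simp
  then show ?thesis
    by (simp add: distr_distr comp_def E_def distr_id2)
qed

text \<open>Exponential tilting: multiplying the density of rate \<open>l\<close> by
  \<open>exp (- t * x)\<close> gives a multiple of the density of rate \<open>l + t\<close>, which
  has mass 1. The index \<open>k\<close> stands for shape \<open>k + 1\<close>, hence the exponent
  \<open>Suc k\<close>.\<close>

lemma integral_exp_erlang:
  assumes l: "l > 0" and t: "t \<ge> 0"
  shows "(\<integral>x. exp (- t * x) \<partial>density lborel (erlang_density k l)) = (l / (l + t)) ^ Suc k"
proof -
  have lt: "l + t > 0" using l t by simp
  interpret P: prob_space "density lborel (erlang_density k (l + t))"
    by (rule prob_space_erlang_density[OF lt])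
  have eq: "erlang_density k l x * exp (- (t * x)) = (l / (l + t)) ^ Suc k * erlang_density k (l + t) x" for x
  proof -
    have "exp (- (l + t) * x) = exp (- l * x) * exp (- (t * x))"
      by (simp add: ring_distribs flip: exp_add)
    then show ?thesis
      using lt by (simp add: erlang_density_def power_divide del: power_Suc)
  qed
  have "(\<integral>x. erlang_density k (l + t) x \<partial>lborel) = (\<integral>x. 1 \<partial>density lborel (erlang_density k (l + t)))"
    using lt by (subst integral_density) auto
  then have 1: "(\<integral>x. erlang_density k (l + t) x \<partial>lborel) = 1" using P.prob_space by simp
  have "(\<integral>x. exp (- t * x) \<partial>density lborel (erlang_density k l)) =
      (\<integral>x. (l / (l + t)) ^ Suc k * erlang_density k (l + t) x \<partial>lborel)"
    using l by (subst integral_density) (auto simp: eq simp del: power_Suc)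
  then show ?thesis using 1 by (simp del: power_Suc)
qed

text \<open>Both sides have the same Laplace transform at the natural numbers. The even number of
  real coordinates matters: it pairs the square roots into the \<open>Suc k\<close>-th power of a
  rational function, as for an Erlang law.\<close>

lemma (in prob_space) distributed_erlang_isometric_normal:
  fixes B :: "'i \<Rightarrow> 'j \<Rightarrow> real"
  assumes I: "card I = 2 * Suc k" and J: "finite J"
    and ind: "indep_vars (\<lambda>_. borel) X J" and s: "s > 0"
    and X: "\<And>j. j \<in> J \<Longrightarrow> distributed M lborel (X j) (\<lambda>x. ennreal (normal_density 0 s x))"
    and iso: "\<And>g. (\<Sum>j\<in>J. (\<Sum>i\<in>I. g i * B i j)\<^sup>2) = (\<Sum>i\<in>I. (g i)\<^sup>2)"
    and c: "c > 0"
  shows "distributed M lborel (\<lambda>\<omega>. c * (\<Sum>i\<in>I. (\<Sum>j\<in>J. B i j * X j \<omega>)\<^sup>2))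
    (erlang_density k (1 / (2 * s\<^sup>2 * c)))"
proof -
  define Q where "Q \<omega> = c * (\<Sum>i\<in>I. (\<Sum>j\<in>J. B i j * X j \<omega>)\<^sup>2)" for \<omega>
  \<comment> \<open>The rate is the reciprocal of \<open>2 * s^2 * c\<close>, the mean of
    \<open>c\<close> times the sum of two squared coordinates.\<close>
  define l where "l = 1 / (2 * s\<^sup>2 * c)"
  have l: "l > 0" using s c by (simp add: l_def)
  have I': "finite I" using I by (metis card.infinite mult_is_0 nat.simps(3) zero_neq_numeral)
  have rv[measurable]: "X j \<in> borel_measurable M" if "j \<in> J" for j
    using ind that by (auto simp: indep_vars_def)
  have Qm[measurable]: "Q \<in> borel_measurable M" unfolding Q_def by measurable
  interpret E: prob_space "density lborel (erlang_density k l)"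
    by (rule prob_space_erlang_density[OF l])
  have "distr M borel Q = density lborel (erlang_density k l)"
  proof (rule Laplace_nat_unique)
    show "real_distribution (distr M borel Q)" by (simp add: real_distribution_distr)
    show "real_distribution (density lborel (erlang_density k l))"
      by (intro real_distribution.intro real_distribution_axioms.intro E.prob_space_axioms) auto
    show "AE x in distr M borel Q. 0 \<le> x"
      using c by (subst AE_distr_iff) (auto simp: Q_def intro!: AE_I2 mult_nonneg_nonneg sum_nonneg)
    show "AE x in density lborel (erlang_density k l). 0 \<le> x"
      by (subst AE_density) (auto simp: erlang_density_def)
  next
    fix n :: nat
    have "(\<integral>x. exp (- real n * x) \<partial>distr M borel Q) =
      expectation (\<lambda>\<omega>. exp (- (real n * c) * (\<Sum>i\<in>I. (\<Sum>j\<in>J. B i j * X j \<omega>)\<^sup>2)))"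
      by (subst integral_distr) (auto simp: Q_def mult_ac)
    also have "\<dots> = (1 / sqrt (1 + 2 * (s\<^sup>2 * (real n * c)))) ^ card I"
      using c by (intro expectation_exp_norm_isometric_normal[OF I' J ind s X iso]) auto
    also have "\<dots> = (1 / (1 + 2 * (s\<^sup>2 * (real n * c)))) ^ Suc k"
      using c unfolding I power_mult by (simp add: power_divide)
    also have "1 / (1 + 2 * (s\<^sup>2 * (real n * c))) = l / (l + real n)"
      using s c by (simp add: l_def field_simps)
    finally show "(\<integral>x. exp (- real n * x) \<partial>distr M borel Q) =
      (\<integral>x. exp (- real n * x) \<partial>density lborel (erlang_density k l))"
      using integral_exp_erlang[OF l, of "real n" k] by simp
  qed
  then show ?thesis
    unfolding distributed_def l_def[symmetric] Q_def[symmetric]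
    by (simp cong: distr_cong)
qed

section \<open>Pseudoinverses and admissible encoding matrices\<close>

lemma mat_adjoint_carrier: "A \<in> carrier_mat n m \<Longrightarrow> mat_adjoint A \<in> carrier_mat m n"
  by (intro carrier_matI) (auto simp: mat_adjoint_def)

lemma mat_adjoint_dim [simp]:
  "dim_row (mat_adjoint A) = dim_col A" "dim_col (mat_adjoint A) = dim_row A"
  by (simp_all add: mat_adjoint_def)

lemma mat_adjoint_index [simp]:
  "i < dim_col A \<Longrightarrow> j < dim_row A \<Longrightarrow> mat_adjoint A $$ (i, j) = conjugate (A $$ (j, i))"
  by (simp add: mat_adjoint_def mat_of_rows_index)

lemma mat_adjoint_adjoint: "mat_adjoint (mat_adjoint A) = A"
  by (rule eq_matI) auto

lemma mat_adjoint_mult: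
  fixes A B :: "complex mat"
  assumes "A \<in> carrier_mat n m" "B \<in> carrier_mat m k"
  shows "mat_adjoint (A * B) = mat_adjoint B * mat_adjoint A"
  using assms by (intro eq_matI) (auto simp: scalar_prod_def mult.commute)

lemma mat_adjoint_one: "mat_adjoint (1\<^sub>m n :: complex mat) = 1\<^sub>m n"
  by (rule eq_matI) auto

text \<open>Penrose's argument. Taking adjoints of products of the Hermitian matrices
  \<open>A * X\<close> and \<open>A * Y\<close> gives \<open>A * X = A * Y\<close>, and dually
  \<open>X * A = Y * A\<close>; then \<open>X = X * A * X\<close> can be rewritten into
  \<open>Y * A * Y = Y\<close>. It justifies the definite description in
  \<open>mp_pinv\<close>.\<close>

lemma is_mp_pinv_unique:
  assumes X: "is_mp_pinv A X" and Y: "is_mp_pinv A Y"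
  shows "X = Y"
proof -
  define n m where "n = dim_row A" and "m = dim_col A"
  have A[simp]: "A \<in> carrier_mat n m" by (simp add: n_def m_def)
  have Xc[simp]: "X \<in> carrier_mat m n" and Yc[simp]: "Y \<in> carrier_mat m n"
    using X Y by (auto simp: is_mp_pinv_def n_def m_def)
  note ax = X[unfolded is_mp_pinv_def] and ay = Y[unfolded is_mp_pinv_def]
  have cs[simp]: "A * X \<in> carrier_mat n n" "A * Y \<in> carrier_mat n n"
    "X * A \<in> carrier_mat m m" "Y * A \<in> carrier_mat m m"
    using mult_carrier_mat[OF A Xc] mult_carrier_mat[OF A Yc] mult_carrier_mat[OF Xc A]
      mult_carrier_mat[OF Yc A] by auto
  have "A * X = (A * Y * A) * X" using ay by simp
  also have "\<dots> = (A * Y) * (A * X)" using assoc_mult_mat[OF cs(2) A Xc] by simp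
  also have "\<dots> = mat_adjoint (A * Y) * mat_adjoint (A * X)" using ax ay by simp
  also have "\<dots> = mat_adjoint ((A * X) * (A * Y))" using mat_adjoint_mult[OF cs(1) cs(2)] by simp
  also have "(A * X) * (A * Y) = (A * X * A) * Y" using assoc_mult_mat[OF cs(1) A Yc] by simp
  also have "mat_adjoint \<dots> = A * Y" using ax ay by simp
  finally have 1: "A * X = A * Y" .
  have "X * A = X * (A * Y * A)" using ay by simp
  also have "\<dots> = X * (A * (Y * A))" using assoc_mult_mat[OF A Yc A] by simp
  also have "\<dots> = (X * A) * (Y * A)" using assoc_mult_mat[OF Xc A cs(4)] by simp
  also have "\<dots> = mat_adjoint (X * A) * mat_adjoint (Y * A)" using ax ay by simp
  also have "\<dots> = mat_adjoint ((Y * A) * (X * A))" using mat_adjoint_mult[OF cs(4) cs(3)] by simp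
  also have "(Y * A) * (X * A) = Y * (A * (X * A))" using assoc_mult_mat[OF Yc A cs(3)] by simp
  also have "A * (X * A) = A * X * A" using assoc_mult_mat[OF A Xc A] by simp
  also have "mat_adjoint (Y * (A * X * A)) = Y * A" using ax ay by simp
  finally have 2: "X * A = Y * A" .
  have "X = X * A * X" using ax by simp
  also have "\<dots> = Y * A * X" using 2 by simp
  also have "\<dots> = Y * (A * X)" using assoc_mult_mat[OF Yc A Xc] by simp
  also have "\<dots> = Y * A * Y" using 1 assoc_mult_mat[OF Yc A Yc] by simp
  also have "\<dots> = Y" using ay by simp
  finally show ?thesis .
qed

lemma mp_pinv_eqI: "is_mp_pinv A X \<Longrightarrow> mp_pinv A = X"
  unfolding mp_pinv_def by (rule the_equality) (auto intro: is_mp_pinv_unique)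

lemma mp_pinv_of_isometry:
  assumes "A \<in> carrier_mat n m" "mat_adjoint A * A = 1\<^sub>m m"
  shows "mp_pinv A = mat_adjoint A"
proof (rule mp_pinv_eqI)
  note A = assms(1) and B = mat_adjoint_carrier[OF assms(1)]
  show "is_mp_pinv A (mat_adjoint A)"
    unfolding is_mp_pinv_def
    using A B assms(2) assoc_mult_mat[OF A B A] mat_adjoint_mult[OF A B]
    by (auto simp: mat_adjoint_adjoint mat_adjoint_one)
qed

text \<open>A kernel vector \<open>v\<close> of the Gram matrix satisfies
  \<open>|A v|^2 = 0\<close>, because this is the inner product of \<open>v\<close> with
  \<open>A^H A v\<close>. Injectivity then gives \<open>v = 0\<close>.\<close>

lemma det_gram_nonzero:
  fixes A :: "complex mat"
  assumes A: "A \<in> carrier_mat n m"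
    and inj: "\<And>v. v \<in> carrier_vec m \<Longrightarrow> A *\<^sub>v v = 0\<^sub>v n \<Longrightarrow> v = 0\<^sub>v m"
  shows "det (mat_adjoint A * A) \<noteq> 0"
proof
  note B = mat_adjoint_carrier[OF A]
  assume "det (mat_adjoint A * A) = 0"
  then obtain v where v: "v \<in> carrier_vec m" "v \<noteq> 0\<^sub>v m" "(mat_adjoint A * A) *\<^sub>v v = 0\<^sub>v m"
    using det_0_iff_vec_prod_zero_field[OF mult_carrier_mat[OF B A]] by blast
  define u where "u = A *\<^sub>v v"
  have u: "u \<in> carrier_vec n" using A v unfolding u_def by simp
  have Bu: "mat_adjoint A *\<^sub>v u = 0\<^sub>v m"
    using v(3) assoc_mult_mat_vec[OF B A v(1)] by (simp add: u_def)
  have "u \<bullet>c u = (\<Sum>j<n. (\<Sum>i<m. A $$ (j, i) * v $ i) * cnj (u $ j))"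
    using A v(1) u by (auto simp: scalar_prod_def u_def lessThan_atLeast0 intro!: sum.cong)
  also have "\<dots> = (\<Sum>i<m. v $ i * cnj (\<Sum>j<n. cnj (A $$ (j, i)) * u $ j))"
    by (simp add: sum_distrib_left sum_distrib_right mult_ac) (rule sum.swap)
  also have "\<dots> = (\<Sum>i<m. v $ i * cnj ((mat_adjoint A *\<^sub>v u) $ i))"
    using A u by (auto simp: scalar_prod_def lessThan_atLeast0 intro!: sum.cong)
  also have "\<dots> = 0" unfolding Bu by simp
  finally have "u = 0\<^sub>v n" using conjugate_square_eq_0_vec[OF u] by simp
  then show False using inj v by (simp add: u_def)
qed

text \<open>For injective \<open>A\<close> the pseudoinverse is the explicit matrix
  \<open>(A^H A)^(-1) A^H\<close>; the Penrose conditions are checked for it.\<close>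

lemma mp_pinv_left_inverse:
  fixes A :: "complex mat"
  assumes A: "A \<in> carrier_mat n m"
    and inj: "\<And>v. v \<in> carrier_vec m \<Longrightarrow> A *\<^sub>v v = 0\<^sub>v n \<Longrightarrow> v = 0\<^sub>v m"
  shows "mp_pinv A \<in> carrier_mat m n" "mp_pinv A * A = 1\<^sub>m m"
proof -
  define H where "H = mat_adjoint A"
  have H: "H \<in> carrier_mat m n" unfolding H_def by (rule mat_adjoint_carrier[OF A])
  have G: "H * A \<in> carrier_mat m m" by (rule mult_carrier_mat[OF H A])
  have "det (H * A) \<noteq> 0"
    using det_gram_nonzero[OF A inj] by (simp add: H_def)
  \<comment> \<open>The argument \<open>()\<close> instantiates the record extension of
    \<open>ring_mat\<close>; \<open>C\<close> is the inverse of the Gram matrix.\<close>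
  from det_non_zero_imp_unit[OF G this, of "()"]
  obtain C where Cc: "C \<in> carrier_mat m m"
    and GC: "H * A * C = 1\<^sub>m m" and CG: "C * (H * A) = 1\<^sub>m m"
    by (auto simp: Units_def ring_mat_def)
  have Ch: "mat_adjoint C \<in> carrier_mat m m" by (rule mat_adjoint_carrier[OF Cc])
  have Gh: "mat_adjoint (H * A) = H * A"
    using mat_adjoint_mult[OF H A] by (simp add: H_def mat_adjoint_adjoint)
  have "mat_adjoint C * (H * A) = 1\<^sub>m m"
    using mat_adjoint_mult[OF G Cc] by (simp add: GC Gh mat_adjoint_one)
  \<comment> \<open>The inverse of a Hermitian matrix is Hermitian; this makes
    \<open>A * X = A * C * H\<close> Hermitian.\<close>
  then have Csym: "mat_adjoint C = C"
    using assoc_mult_mat[OF Ch G Cc] GC Ch Cc by simp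
  define X where "X = C * H"
  have X: "X \<in> carrier_mat m n" unfolding X_def by (rule mult_carrier_mat[OF Cc H])
  have XA: "X * A = 1\<^sub>m m" using assoc_mult_mat[OF Cc H A] CG by (simp add: X_def)
  have AC: "A * C \<in> carrier_mat n m" by (rule mult_carrier_mat[OF A Cc])
  have AX: "A * X = A * C * H" unfolding X_def using assoc_mult_mat[OF A Cc H] by simp
  have "mat_adjoint (A * X) = mat_adjoint H * (mat_adjoint C * mat_adjoint A)"
    unfolding AX using mat_adjoint_mult[OF AC H] mat_adjoint_mult[OF A Cc] by simp
  also have "\<dots> = A * X" by (simp add: Csym H_def X_def mat_adjoint_adjoint)
  finally have "is_mp_pinv A X"
    unfolding is_mp_pinv_def
    using A X XA assoc_mult_mat[OF A X A] by (auto simp: mat_adjoint_one)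
  then have "mp_pinv A = X" by (rule mp_pinv_eqI)
  then show "mp_pinv A \<in> carrier_mat m n" "mp_pinv A * A = 1\<^sub>m m" using X XA by auto
qed

section \<open>Row submatrices and injectivity of admissible matrices\<close>

lemma submatrix_rows_carrier:
  assumes "A \<in> carrier_mat n m" "S \<subseteq> {..<n}"
  shows "submatrix A S UNIV \<in> carrier_mat (card S) m"
proof -
  have "{i. i < n \<and> i \<in> S} = S" using assms(2) by auto
  then show ?thesis using assms(1) by (intro carrier_matI) (auto simp: dim_submatrix)
qed

lemma submatrix_rows_index:
  assumes "A \<in> carrier_mat n m" "S \<subseteq> {..<n}" "i < card S" "j < m"
  shows "submatrix A S UNIV $$ (i, j) = A $$ (pick S i, j)"
proof -
  have "{i. i < n \<and> i \<in> S} = S" using assms(2) by auto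
  then show ?thesis using assms submatrix_index[of i A S j UNIV] by (auto simp: pick_UNIV)
qed

text \<open>The rank condition for the first \<open>L\<close> rows alone gives an invertible square
  block, and a kernel vector of \<open>\<Phi>\<close> is also one of this block.\<close>

lemma admissible_enc_injective:
  assumes adm: "admissible_enc L Lt \<Phi>" and le: "L \<le> Lt"
    and v: "v \<in> carrier_vec L" and z: "\<Phi> *\<^sub>v v = 0\<^sub>v Lt"
  shows "v = 0\<^sub>v L"
proof (rule ccontr)
  assume nz: "v \<noteq> 0\<^sub>v L"
  have \<Phi>: "\<Phi> \<in> carrier_mat Lt L" using adm by (simp add: admissible_enc_def)
  define S where "S = {..<L}"
  have S: "S \<subseteq> {..<Lt}" "card S = L" using le by (auto simp: S_def)
  define A where "A = submatrix \<Phi> S UNIV"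
  have A: "A \<in> carrier_mat L L" using submatrix_rows_carrier[OF \<Phi> S(1)] S(2) by (simp add: A_def)
  have "vec_space.rank L A = L" using adm S by (auto simp: admissible_enc_def A_def)
  then have det: "det A \<noteq> 0" using vec_space.det_rank_iff[OF A] by blast
  have "A *\<^sub>v v = 0\<^sub>v L"
  proof (rule eq_vecI)
    fix i assume "i < dim_vec (0\<^sub>v L :: complex vec)"
    then have i: "i < L" by simp
    then have p: "pick S i < Lt" using pick_in_set_le[of i S] S by auto
    have "(A *\<^sub>v v) $ i = (\<Phi> *\<^sub>v v) $ pick S i"
      using A \<Phi> v i p S submatrix_rows_index[OF \<Phi> S(1), of i]
      by (auto simp: scalar_prod_def A_def intro!: sum.cong)
    then show "(A *\<^sub>v v) $ i = 0\<^sub>v L $ i" using z p i by simp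
  qed (use A in auto)
  then show False using det det_0_iff_vec_prod_zero_field[OF A] v nz by blast
qed

lemma admissible_enc_pinv:
  assumes "admissible_enc L Lt \<Phi>" "L \<le> Lt"
  shows "mp_pinv \<Phi> \<in> carrier_mat L Lt" "mp_pinv \<Phi> * \<Phi> = 1\<^sub>m L"
  using mp_pinv_left_inverse[of \<Phi> Lt L] admissible_enc_injective[OF assms] assms(1)
  by (auto simp: admissible_enc_def)

text \<open>Expanding \<open>|X - A^H|^2\<close> gives \<open>|X|^2 + |A|^2\<close> minus twice the
  real part of the trace of \<open>X * A\<close>. Both \<open>|A|^2\<close> and that trace equal
  \<open>m\<close>, so the difference to \<open>|X|^2\<close> is exactly \<open>- m\<close>.\<close>

lemma frobenius_left_inverse:
  fixes A X :: "complex mat"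
  assumes A: "A \<in> carrier_mat n m" and X: "X \<in> carrier_mat m n"
    and XA: "X * A = 1\<^sub>m m" and tr: "mat_tr (mat_adjoint A * A) = of_nat m"
  shows "(\<Sum>i<m. \<Sum>j<n. (cmod (X $$ (i, j)))\<^sup>2) =
    real m + (\<Sum>i<m. \<Sum>j<n. (cmod (X $$ (i, j) - cnj (A $$ (j, i))))\<^sup>2)"
proof -
  have "mat_tr (mat_adjoint A * A) = (\<Sum>i<m. \<Sum>j<n. cnj (A $$ (j, i)) * A $$ (j, i))"
    using A by (auto simp: mat_tr_def scalar_prod_def lessThan_atLeast0 intro!: sum.cong)
  also have "\<dots> = complex_of_real (\<Sum>i<m. \<Sum>j<n. (cmod (A $$ (j, i)))\<^sup>2)"
    by (simp only: complex_norm_square of_real_sum mult.commute)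
  finally have "complex_of_real (real m) = complex_of_real (\<Sum>i<m. \<Sum>j<n. (cmod (A $$ (j, i)))\<^sup>2)"
    using tr by simp
  then have a: "(\<Sum>i<m. \<Sum>j<n. (cmod (A $$ (j, i)))\<^sup>2) = real m"
    unfolding of_real_eq_iff by simp
  have "(\<Sum>i<m. \<Sum>j<n. X $$ (i, j) * A $$ (j, i)) = (\<Sum>i<m. (X * A) $$ (i, i))"
    using A X by (auto simp: scalar_prod_def lessThan_atLeast0 intro!: sum.cong)
  also have "\<dots> = of_nat m" using XA by simp
  finally have "Re (\<Sum>i<m. \<Sum>j<n. X $$ (i, j) * A $$ (j, i)) = real m" by simp
  then have b: "(\<Sum>i<m. \<Sum>j<n. Re (X $$ (i, j) * A $$ (j, i))) = real m" by simp
  have "(cmod (x - cnj y))\<^sup>2 = (cmod x)\<^sup>2 + (cmod y)\<^sup>2 - 2 * Re (x * y)" for x y :: complex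
    unfolding cmod_power2 by (simp add: power2_eq_square algebra_simps)
  then have "(\<Sum>i<m. \<Sum>j<n. (cmod (X $$ (i, j) - cnj (A $$ (j, i))))\<^sup>2) =
     (\<Sum>i<m. \<Sum>j<n. (cmod (X $$ (i, j)))\<^sup>2) + (\<Sum>i<m. \<Sum>j<n. (cmod (A $$ (j, i)))\<^sup>2)
       - 2 * (\<Sum>i<m. \<Sum>j<n. Re (X $$ (i, j) * A $$ (j, i)))"
    by (simp only: sum.distrib sum_subtractf sum_distrib_left)
  then show ?thesis unfolding a b by simp
qed

lemma frobenius_left_inverse_ge:
  fixes A X :: "complex mat"
  assumes "A \<in> carrier_mat n m" "X \<in> carrier_mat m n"
    and "X * A = 1\<^sub>m m" "mat_tr (mat_adjoint A * A) = of_nat m"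
  shows "real m \<le> (\<Sum>i<m. \<Sum>j<n. (cmod (X $$ (i, j)))\<^sup>2)"
  unfolding frobenius_left_inverse[OF assms] by (auto intro!: sum_nonneg)

text \<open>Equality makes the distance between \<open>X\<close> and the adjoint of \<open>A\<close>
  vanish, so the claim is \<open>X * A = 1\<close> with \<open>X\<close> replaced.\<close>

lemma frobenius_left_inverse_eqD:
  fixes A X :: "complex mat"
  assumes A: "A \<in> carrier_mat n m" and X: "X \<in> carrier_mat m n"
    and XA: "X * A = 1\<^sub>m m" "mat_tr (mat_adjoint A * A) = of_nat m"
    and eq: "(\<Sum>i<m. \<Sum>j<n. (cmod (X $$ (i, j)))\<^sup>2) = real m"
  shows "mat_adjoint A * A = 1\<^sub>m m"
proof -
  have "(\<Sum>i<m. \<Sum>j<n. (cmod (X $$ (i, j) - cnj (A $$ (j, i))))\<^sup>2) = 0"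
    using frobenius_left_inverse[OF A X XA] eq by simp
  then have "X $$ (i, j) = cnj (A $$ (j, i))" if "i < m" "j < n" for i j
    using that by (auto simp: sum_nonneg_eq_0_iff sum_nonneg)
  then have "X = mat_adjoint A"
    using A X by (intro eq_matI) auto
  then show ?thesis using XA by simp
qed

section \<open>Partial Fourier matrices\<close>

lemma sum_powers_root_of_unity:
  assumes "q ^ n = 1" "q \<noteq> (1::complex)"
  shows "(\<Sum>j<n. q ^ j) = 0"
  using assms geometric_sum[of q n] by simp

text \<open>A kernel vector is the coefficient list of a polynomial of degree below \<open>n\<close>
  that vanishes at the \<open>n\<close> distinct nodes \<open>z i\<close>, so it is zero.\<close>

lemma det_vandermonde_nonzero:
  fixes A :: "complex mat"
  assumes A: "A \<in> carrier_mat n n" and c: "c \<noteq> 0"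
    and ix: "\<And>i j. i < n \<Longrightarrow> j < n \<Longrightarrow> A $$ (i, j) = c * z i ^ j"
    and inj: "inj_on z {..<n}"
  shows "det A \<noteq> 0"
proof
  assume "det A = 0"
  then obtain v where v: "v \<in> carrier_vec n" "v \<noteq> 0\<^sub>v n" "A *\<^sub>v v = 0\<^sub>v n"
    using det_0_iff_vec_prod_zero_field[OF A] by blast
  define p where "p = (\<Sum>j<n. monom (v $ j) j)"
  have cf: "coeff p k = (if k < n then v $ k else 0)" for k
    by (simp add: p_def coeff_sum)
  have root: "poly p (z i) = 0" if i: "i < n" for i
  proof -
    have "(A *\<^sub>v v) $ i = c * poly p (z i)"
      using A v(1) i by (auto simp: p_def poly_sum poly_monom scalar_prod_def ix lessThan_atLeast0
          sum_distrib_left mult_ac simp del: mult_cancel_left1 intro!: sum.cong)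
    then show ?thesis using v(3) i c by simp
  qed
  have "p = 0"
  proof (rule ccontr)
    assume p: "p \<noteq> 0"
    have "n > 0" using p by (auto simp: p_def intro: Nat.gr0I)
    have "n = card (z ` {..<n})" using inj by (simp add: card_image)
    also have "\<dots> \<le> card {x. poly p x = 0}"
      using root p by (intro card_mono poly_roots_finite) auto
    also have "\<dots> \<le> degree p" using p by (rule card_poly_roots_bound)
    also have "degree p < n"
      using \<open>n > 0\<close> p cf by (metis leading_coeff_0_iff)
    finally show False by simp
  qed
  then have "v $ k = 0" if "k < n" for k using cf[of k] that by simp
  then show False using v by auto
qed

text \<open>The witness consists of the first \<open>L\<close> columns of the unitary Fourier matrix
  of size \<open>Lt\<close>. It shows that the lower bound on the error is attained.\<close>

lemma exists_admissible_isometry: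
  assumes "1 \<le> L" "L \<le> Lt"
  shows "\<exists>\<Phi>. admissible_enc L Lt \<Phi> \<and> mat_adjoint \<Phi> * \<Phi> = 1\<^sub>m L"
proof -
  have n: "Lt > 0" using assms by simp
  define z where "z j = cis (2 * pi * real j / real Lt)" for j
  define c where "c = complex_of_real (1 / sqrt (real Lt))"
  have c: "c \<noteq> 0" "cnj c * c = 1 / of_nat Lt"
    using n by (auto simp: c_def simp flip: of_real_mult of_real_inverse)
  have inj: "inj_on z {..<Lt}"
    using Complex.bij_betw_roots_unity[OF n] unfolding z_def by (rule bij_betw_imp_inj_on)
  have zpow: "z j = z 1 ^ j" for j
    unfolding z_def Complex.DeMoivre by (simp add: mult_ac)
  have zn: "z 1 ^ Lt = 1" unfolding z_def Complex.DeMoivre using n by simp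
  have zz: "cnj (z j) * z j = 1" for j by (simp add: z_def cis_cnj cis_mult)
  define \<Phi> where "\<Phi> = mat Lt L (\<lambda>(j, l). c * z j ^ l)"
  have \<Phi>: "\<Phi> \<in> carrier_mat Lt L" by (simp add: \<Phi>_def)
  have orth: "(\<Sum>j<Lt. cnj (z j ^ l) * z j ^ m) = (if l = m then of_nat Lt else 0)"
    if lm: "l < L" "m < L" for l m
  proof (cases "l = m")
    case True
    then show ?thesis by (simp add: zz flip: power_mult_distrib)
  next
    case False
    \<comment> \<open>Since \<open>z 1\<close> lies on the unit circle, \<open>q\<close> is
      \<open>z 1\<close> to the power \<open>m - l\<close>: the inner product of the two columns is
      a geometric sum over an \<open>Lt\<close>-th root of unity other than 1.\<close>
    define q where "q = cnj (z 1) ^ l * z 1 ^ m"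
    have "q ^ Lt = cnj (z 1 ^ Lt) ^ l * (z 1 ^ Lt) ^ m"
      by (simp add: q_def power_mult_distrib mult.commute flip: power_mult)
    then have "q ^ Lt = 1" by (simp only: zn) simp
    moreover have "q \<noteq> 1"
    proof
      assume "q = 1"
      then have "z l = z l * q" by simp
      also have "\<dots> = (cnj (z 1) * z 1) ^ l * z m"
        unfolding q_def zpow[of l] zpow[of m] power_mult_distrib by (simp add: mult_ac)
      finally have "z l = z m" by (simp add: zz)
      then show False using inj lm assms False by (auto dest!: inj_onD)
    qed
    moreover have "cnj (z j ^ l) * z j ^ m = q ^ j" for j
      unfolding q_def zpow[of j] by (simp add: power_mult_distrib mult.commute flip: power_mult)
    ultimately show ?thesis using False by (simp add: sum_powers_root_of_unity del: complex_cnj_power)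
  qed
  have iso: "mat_adjoint \<Phi> * \<Phi> = 1\<^sub>m L"
  proof (rule eq_matI)
    fix l m assume "l < dim_row (1\<^sub>m L :: complex mat)" "m < dim_col (1\<^sub>m L :: complex mat)"
    then have lm: "l < L" "m < L" by auto
    then have "(mat_adjoint \<Phi> * \<Phi>) $$ (l, m) = (\<Sum>j<Lt. (cnj c * c) * (cnj (z j ^ l) * z j ^ m))"
      by (auto simp: \<Phi>_def scalar_prod_def lessThan_atLeast0 mult_ac intro!: sum.cong)
    then show "(mat_adjoint \<Phi> * \<Phi>) $$ (l, m) = 1\<^sub>m L $$ (l, m)"
      unfolding sum_distrib_left[symmetric] c(2) orth[OF lm] using lm n by simp
  qed (auto simp: \<Phi>_def)
  have "vec_space.rank L (submatrix \<Phi> S UNIV) = L" if S: "S \<subseteq> {..<Lt}" "card S = L" for S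
  proof -
    define A where "A = submatrix \<Phi> S UNIV"
    have A: "A \<in> carrier_mat L L" using submatrix_rows_carrier[OF \<Phi> S(1)] S(2) by (simp add: A_def)
    have p: "pick S i < Lt" if "i < L" for i using pick_in_set_le[of i S] S that by auto
    \<comment> \<open>Distinct rows have distinct nodes, so each square row submatrix is
      \<open>c\<close> times a Vandermonde matrix.\<close>
    have "inj_on (pick S) {..<L}"
      using S(2) by (intro inj_onI) (metis card_pick_le lessThan_iff)
    then have "inj_on (z \<circ> pick S) {..<L}"
      using p inj by (intro comp_inj_on) (auto intro: inj_on_subset)
    moreover have "A $$ (i, j) = c * (z \<circ> pick S) i ^ j" if "i < L" "j < L" for i j
      using submatrix_rows_index[OF \<Phi> S(1), of i j] S(2) that p by (simp add: A_def \<Phi>_def)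
    ultimately have "det A \<noteq> 0" using det_vandermonde_nonzero[OF A c(1)] by blast
    then show ?thesis using vec_space.det_rank_iff[OF A] by (simp add: A_def)
  qed
  then have "admissible_enc L Lt \<Phi>"
    using \<Phi> iso by (simp add: admissible_enc_def mat_tr_def)
  then show ?thesis using iso by blast
qed

section \<open>Distortion and computation error\<close>

text \<open>The real coordinates are indexed by pairs, with \<open>True\<close> for real and
  \<open>False\<close> for imaginary parts; each has half of the complex variance.\<close>

lemma (in prob_space) cn_vec_coords:
  assumes Z: "cn_vec M n v Z" and v: "v > 0"
  obtains N :: "nat \<times> bool \<Rightarrow> 'a \<Rightarrow> real"
  where "indep_vars (\<lambda>_. borel) N ({..<n} \<times> UNIV)"
    and "\<And>p. p \<in> {..<n} \<times> UNIV \<Longrightarrow>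
      distributed M lborel (N p) (\<lambda>x. ennreal (normal_density 0 (sqrt (v / 2)) x))"
    and "\<And>j \<omega>. N (j, True) \<omega> = Re (Z \<omega> j)" "\<And>j \<omega>. N (j, False) \<omega> = Im (Z \<omega> j)"
proof
  let ?N = "\<lambda>(i, b) \<omega>. if b then Re (Z \<omega> i) else Im (Z \<omega> i)"
  show "indep_vars (\<lambda>_. borel) ?N ({..<n} \<times> UNIV)"
    using Z by (simp add: cn_vec_def)
  show "distributed M lborel (?N p) (\<lambda>x. ennreal (normal_density 0 (sqrt (v / 2)) x))"
    if "p \<in> {..<n} \<times> UNIV" for p
    using Z that by (cases p; cases "snd p") (auto simp: cn_vec_def)
qed simp_all

lemma sum_lessThan_times_bool:
  "(\<Sum>p\<in>{..<n} \<times> (UNIV :: bool set). f p) = (\<Sum>j<n. f (j, True) + f (j, False))"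
  for f :: "nat \<times> bool \<Rightarrow> 'b::comm_monoid_add"
proof -
  have "sum f ({..<n} \<times> UNIV) = (\<Sum>j<n. \<Sum>b\<in>UNIV. f (j, b))"
    by (simp add: sum.cartesian_product)
  then show ?thesis by (simp add: UNIV_bool add.commute)
qed

text \<open>The real and the imaginary part are both real linear forms whose coefficients have
  squared norm \<open>|x|^2\<close>, so each contributes half of the total.\<close>

lemma (in prob_space) cn_vec_linear_second_moment:
  assumes Z: "cn_vec M n v Z" and v: "v > 0"
  shows "has_bochner_integral M (\<lambda>\<omega>. (cmod (\<Sum>j<n. x j * Z \<omega> j))\<^sup>2) (v * (\<Sum>j<n. (cmod (x j))\<^sup>2))"
proof -
  obtain N where ind: "indep_vars (\<lambda>_. borel) N ({..<n} \<times> UNIV)"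
    and nrm: "\<And>p. p \<in> {..<n} \<times> UNIV \<Longrightarrow>
      distributed M lborel (N p) (\<lambda>x. ennreal (normal_density 0 (sqrt (v / 2)) x))"
    and N: "\<And>j \<omega>. N (j, True) \<omega> = Re (Z \<omega> j)" "\<And>j \<omega>. N (j, False) \<omega> = Im (Z \<omega> j)"
    using cn_vec_coords[OF Z v] by metis
  define a where "a p = (if snd p then Re (x (fst p)) else - Im (x (fst p)))" for p
  define b where "b p = (if snd p then Im (x (fst p)) else Re (x (fst p)))" for p
  have fin: "finite ({..<n} \<times> (UNIV :: bool set))" by simp
  have s: "sqrt (v / 2) > 0" "(sqrt (v / 2))\<^sup>2 = v / 2" using v by auto
  note m = second_moment_indep_normal[OF fin ind s(1) nrm]
  have re: "(\<Sum>p\<in>{..<n} \<times> UNIV. a p * N p \<omega>) = Re (\<Sum>j<n. x j * Z \<omega> j)" for \<omega>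
    by (simp add: sum_lessThan_times_bool a_def N)
  have im: "(\<Sum>p\<in>{..<n} \<times> UNIV. b p * N p \<omega>) = Im (\<Sum>j<n. x j * Z \<omega> j)" for \<omega>
    by (simp add: sum_lessThan_times_bool b_def N add.commute)
  have sa: "(\<Sum>p\<in>{..<n} \<times> UNIV. (a p)\<^sup>2) = (\<Sum>j<n. (cmod (x j))\<^sup>2)"
    by (simp add: sum_lessThan_times_bool a_def cmod_power2)
  have sb: "(\<Sum>p\<in>{..<n} \<times> UNIV. (b p)\<^sup>2) = (\<Sum>j<n. (cmod (x j))\<^sup>2)"
    by (simp add: sum_lessThan_times_bool b_def cmod_power2 add.commute)
  have "has_bochner_integral M (\<lambda>\<omega>. (Re (\<Sum>j<n. x j * Z \<omega> j))\<^sup>2 + (Im (\<Sum>j<n. x j * Z \<omega> j))\<^sup>2)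
      (v / 2 * (\<Sum>j<n. (cmod (x j))\<^sup>2) + v / 2 * (\<Sum>j<n. (cmod (x j))\<^sup>2))"
    using has_bochner_integral_add[OF m[of a] m[of b]] unfolding re im sa sb s(2) .
  then show ?thesis unfolding cmod_power2[symmetric] by (simp add: mult.commute)
qed

lemma isometry_norm:
  fixes A :: "complex mat"
  assumes A: "A \<in> carrier_mat n m" and iso: "mat_adjoint A * A = 1\<^sub>m m"
  shows "(\<Sum>j<n. (cmod (\<Sum>i<m. A $$ (j, i) * u i))\<^sup>2) = (\<Sum>i<m. (cmod (u i))\<^sup>2)"
proof -
  have orth: "(\<Sum>j<n. A $$ (j, i) * cnj (A $$ (j, k))) = (if i = k then 1 else 0)" if "i < m" "k < m" for i k
  proof -
    have "(\<Sum>j<n. A $$ (j, i) * cnj (A $$ (j, k))) = (mat_adjoint A * A) $$ (k, i)"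
      using A that by (auto simp: scalar_prod_def lessThan_atLeast0 mult.commute intro!: sum.cong)
    then show ?thesis using that by (auto simp: iso)
  qed
  have "complex_of_real (\<Sum>j<n. (cmod (\<Sum>i<m. A $$ (j, i) * u i))\<^sup>2) =
    (\<Sum>j<n. \<Sum>i<m. \<Sum>k<m. (u i * cnj (u k)) * (A $$ (j, i) * cnj (A $$ (j, k))))"
    by (simp only: of_real_sum complex_norm_square cnj_sum complex_cnj_mult sum_product mult_ac)
  also have "\<dots> = (\<Sum>i<m. \<Sum>j<n. \<Sum>k<m. (u i * cnj (u k)) * (A $$ (j, i) * cnj (A $$ (j, k))))"
    by (rule sum.swap)
  also have "\<dots> = (\<Sum>i<m. \<Sum>k<m. \<Sum>j<n. (u i * cnj (u k)) * (A $$ (j, i) * cnj (A $$ (j, k))))"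
    by (rule sum.cong[OF refl], rule sum.swap)
  also have "\<dots> = (\<Sum>i<m. \<Sum>k<m. (u i * cnj (u k)) * (if i = k then 1 else 0))"
    unfolding sum_distrib_left[symmetric] by (intro sum.cong refl) (simp add: orth)
  also have "\<dots> = (\<Sum>i<m. u i * cnj (u i))"
    by (intro sum.cong refl) (simp add: if_distrib[of "\<lambda>x. _ * x"] cong: if_cong)
  also have "\<dots> = complex_of_real (\<Sum>i<m. (cmod (u i))\<^sup>2)"
    by (simp only: of_real_sum complex_norm_square)
  finally show ?thesis unfolding of_real_eq_iff .
qed

text \<open>The complex statement is reduced to \<open>2 * Suc k\<close> real coordinates.\<close>

lemma (in prob_space) cn_vec_isometry_erlang:
  fixes A :: "complex mat"
  assumes Z: "cn_vec M n v Z" and v: "v > 0"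
    and A: "A \<in> carrier_mat n (Suc k)" and iso: "mat_adjoint A * A = 1\<^sub>m (Suc k)" and c: "c > 0"
  shows "distributed M lborel (\<lambda>\<omega>. c * (\<Sum>i<Suc k. (cmod (\<Sum>j<n. cnj (A $$ (j, i)) * Z \<omega> j))\<^sup>2))
    (erlang_density k (1 / (v * c)))"
proof -
  obtain N where ind: "indep_vars (\<lambda>_. borel) N ({..<n} \<times> UNIV)"
    and nrm: "\<And>p. p \<in> {..<n} \<times> UNIV \<Longrightarrow>
      distributed M lborel (N p) (\<lambda>x. ennreal (normal_density 0 (sqrt (v / 2)) x))"
    and N: "\<And>j \<omega>. N (j, True) \<omega> = Re (Z \<omega> j)" "\<And>j \<omega>. N (j, False) \<omega> = Im (Z \<omega> j)"
    using cn_vec_coords[OF Z v] by metis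
  let ?I = "{..<Suc k} \<times> (UNIV :: bool set)" and ?J = "{..<n} \<times> (UNIV :: bool set)"
  \<comment> \<open>\<open>B\<close> is the real form of the adjoint of \<open>A\<close>, each entry
    \<open>cnj a\<close> becoming a 2 by 2 block. Its transpose is the real form of \<open>A\<close>
    itself, which preserves norms by \<open>isometry_norm\<close>.\<close>
  define B where "B p q = (let a = A $$ (fst q, fst p) in
     if snd p then (if snd q then Re a else Im a) else (if snd q then - Im a else Re a))" for p q :: "nat \<times> bool"
  have isoB: "(\<Sum>q\<in>?J. (\<Sum>p\<in>?I. g p * B p q)\<^sup>2) = (\<Sum>p\<in>?I. (g p)\<^sup>2)" for g
  proof -
    define u where "u i = Complex (g (i, True)) (g (i, False))" for i
    have "(\<Sum>p\<in>?I. g p * B p (j, True)) = Re (\<Sum>i<Suc k. A $$ (j, i) * u i)"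
      "(\<Sum>p\<in>?I. g p * B p (j, False)) = Im (\<Sum>i<Suc k. A $$ (j, i) * u i)" for j
      by (simp_all add: sum_lessThan_times_bool B_def u_def mult.commute del: sum.lessThan_Suc)
    then have "(\<Sum>q\<in>?J. (\<Sum>p\<in>?I. g p * B p q)\<^sup>2) = (\<Sum>j<n. (cmod (\<Sum>i<Suc k. A $$ (j, i) * u i))\<^sup>2)"
      unfolding sum_lessThan_times_bool[where n=n] cmod_power2 by simp
    also have "\<dots> = (\<Sum>i<Suc k. (cmod (u i))\<^sup>2)" by (rule isometry_norm[OF A iso])
    also have "\<dots> = (\<Sum>p\<in>?I. (g p)\<^sup>2)"
      unfolding sum_lessThan_times_bool cmod_power2 u_def by simp
    finally show ?thesis .
  qed
  have "(\<Sum>p\<in>?I. (\<Sum>q\<in>?J. B p q * N q \<omega>)\<^sup>2) =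
      (\<Sum>i<Suc k. (cmod (\<Sum>j<n. cnj (A $$ (j, i)) * Z \<omega> j))\<^sup>2)" for \<omega>
  proof -
    have "(\<Sum>q\<in>?J. B (i, True) q * N q \<omega>) = Re (\<Sum>j<n. cnj (A $$ (j, i)) * Z \<omega> j)"
      "(\<Sum>q\<in>?J. B (i, False) q * N q \<omega>) = Im (\<Sum>j<n. cnj (A $$ (j, i)) * Z \<omega> j)" for i
      by (simp_all add: sum_lessThan_times_bool B_def N)
    then show ?thesis
      unfolding sum_lessThan_times_bool[where n="Suc k"] cmod_power2 by simp
  qed
  moreover have "card ?I = 2 * Suc k" by (simp add: card_cartesian_product)
  moreover have "sqrt (v / 2) > 0" "2 * (sqrt (v / 2))\<^sup>2 * c = v * c" using v by auto
  ultimately show ?thesis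
    using distributed_erlang_isometric_normal[OF _ _ ind _ nrm isoB c, of k] by simp
qed

text \<open>Shape \<open>k + 1\<close>, and the scale is the reciprocal of the rate. The point 0 is
  excluded because for \<open>k = 0\<close> the two densities differ there.\<close>

lemma gamma_density_eq_erlang:
  assumes "x \<noteq> 0" "th > 0"
  shows "gamma_density (real (Suc k)) th x = erlang_density k (1 / th) x"
proof -
  have "Gamma (real (Suc k)) = fact k" using Gamma_fact[of k, where ?'a=real] by (simp add: add.commute)
  moreover have "th powr real (Suc k) = th ^ Suc k" using assms(2) by (rule powr_realpow)
  moreover have "x powr (real (Suc k) - 1) = x ^ k" if "x > 0" using that by (simp add: powr_realpow)
  ultimately show ?thesis using assms
    by (auto simp: gamma_density_def erlang_density_def power_divide simp del: of_nat_Suc power_Suc)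
qed

text \<open>Channel inversion cancels the \<open>h k\<close>, and the left inverse recovers the
  target exactly; what remains of the estimate is noise filtered by the pseudoinverse.\<close>

lemma ota_dist_eq:
  assumes adm: "admissible_enc L Lt \<Phi>" and le: "L \<le> Lt" and P: "P > 0" and h: "\<forall>k<K. h k \<noteq> 0"
  shows "ota_dist K L Lt h w nz \<Phi> P \<omega> =
    1 / (real L * P) * (\<Sum>i<L. (cmod (\<Sum>j<Lt. mp_pinv \<Phi> $$ (i, j) * nz \<omega> j))\<^sup>2)"
proof -
  define X where "X = mp_pinv \<Phi>"
  have \<Phi>: "\<Phi> \<in> carrier_mat Lt L" using adm by (simp add: admissible_enc_def)
  have X: "X \<in> carrier_mat L Lt" and XA: "X * \<Phi> = 1\<^sub>m L"
    using admissible_enc_pinv[OF adm le] by (auto simp: X_def)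
  define W where "W = target_vec K L w \<omega>"
  have W: "W \<in> carrier_vec L" by (simp add: W_def target_vec_def)
  define r where "r = complex_of_real (sqrt P)"
  have r: "r \<noteq> 0" using P by (simp add: r_def)
  define n where "n = vec Lt (nz \<omega>)"
  have n: "n \<in> carrier_vec Lt" by (simp add: n_def)
  have rx: "rx_vec K L Lt h w nz \<Phi> P \<omega> = r \<cdot>\<^sub>v (\<Phi> *\<^sub>v W) + n"
  proof (rule eq_vecI)
    fix j assume "j < dim_vec (r \<cdot>\<^sub>v (\<Phi> *\<^sub>v W) + n)"
    then have j: "j < Lt" using n by simp
    have "(\<Sum>k<K. h k * (tx_vec L h w \<Phi> P k \<omega> $ j)) = (\<Sum>k<K. r * (\<Sum>l<L. \<Phi> $$ (j, l) * w k \<omega> l))"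
      using \<Phi> j h by (intro sum.cong refl)
        (auto simp: tx_vec_def msg_vec_def scalar_prod_def r_def lessThan_atLeast0)
    also have "\<dots> = r * (\<Phi> *\<^sub>v W) $ j"
      using \<Phi> j by (simp add: W_def target_vec_def scalar_prod_def sum_distrib_left lessThan_atLeast0)
        (rule sum.swap)
    finally show "rx_vec K L Lt h w nz \<Phi> P \<omega> $ j = (r \<cdot>\<^sub>v (\<Phi> *\<^sub>v W) + n) $ j"
      using \<Phi> j by (simp add: rx_vec_def n_def)
  qed (simp add: rx_vec_def n_def)
  have \<Phi>W: "\<Phi> *\<^sub>v W \<in> carrier_vec Lt" using \<Phi> W by simp
  have "X *\<^sub>v (\<Phi> *\<^sub>v W) = W" using assoc_mult_mat_vec[OF X \<Phi> W] XA W by simp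
  then have Xrx: "X *\<^sub>v rx_vec K L Lt h w nz \<Phi> P \<omega> = r \<cdot>\<^sub>v W + X *\<^sub>v n"
    unfolding rx using mult_add_distrib_mat_vec[OF X _ n, of "r \<cdot>\<^sub>v (\<Phi> *\<^sub>v W)"] \<Phi>W
      mult_mat_vec[OF X \<Phi>W, of r] by simp
  have diff: "est_vec K L Lt h w nz \<Phi> P \<omega> $ i - W $ i = (\<Sum>j<Lt. X $$ (i, j) * nz \<omega> j) / r"
    if i: "i < L" for i
    unfolding est_vec_def X_def[symmetric] Xrx r_def[symmetric]
    using i W X r by (simp add: scalar_prod_def n_def lessThan_atLeast0 field_simps)
  have nr: "(cmod (z / r))\<^sup>2 = (cmod z)\<^sup>2 / P" for z
    using P by (simp add: norm_divide power_divide r_def)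
  show ?thesis
    unfolding ota_dist_def distortion_def W_def[symmetric] X_def[symmetric]
    by (simp add: diff nr mult.commute flip: sum_divide_distrib)
qed

lemma comp_error_eq:
  assumes adm: "admissible_enc L Lt \<Phi>" and le: "L \<le> Lt" and P: "P > 0" and h: "\<forall>k<K. h k \<noteq> 0"
    and M: "prob_space M" and nz: "cn_vec M Lt N0 nz" and N0: "N0 > 0"
  shows "comp_error M K L Lt h w nz \<Phi> P =
    N0 / (real L * P) * (\<Sum>i<L. \<Sum>j<Lt. (cmod (mp_pinv \<Phi> $$ (i, j)))\<^sup>2)"
proof -
  interpret prob_space M by fact
  have "has_bochner_integral M
    (\<lambda>\<omega>. 1 / (real L * P) * (\<Sum>i<L. (cmod (\<Sum>j<Lt. mp_pinv \<Phi> $$ (i, j) * nz \<omega> j))\<^sup>2))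
    (1 / (real L * P) * (\<Sum>i<L. N0 * (\<Sum>j<Lt. (cmod (mp_pinv \<Phi> $$ (i, j)))\<^sup>2)))"
    by (intro has_bochner_integral_mult_right has_bochner_integral_sum
        cn_vec_linear_second_moment[OF nz N0])
  from has_bochner_integral_integral_eq[OF this] show ?thesis
    unfolding comp_error_def ota_dist_eq[OF adm le P h]
    by (simp add: sum_distrib_left[symmetric])
qed

text \<open>The power constraints of all users reduce to the one of the weakest channel, which is an
  upper bound on \<open>P\<close>.\<close>

lemma feasible_iff:
  assumes K: "K \<ge> 1" and L: "1 \<le> L" "L \<le> Lt" and h: "\<forall>k<K. h k \<noteq> 0" and PW: "PW > 0"
  defines "hmin \<equiv> Min ((\<lambda>k. (cmod (h k))\<^sup>2) ` {..<K})"
  shows "feasible K L Lt h PW PX \<Phi> P \<longleftrightarrow>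
    P > 0 \<and> admissible_enc L Lt \<Phi> \<and> P \<le> PX * hmin / (real L / real Lt * PW)"
    and "hmin > 0"
proof -
  define c where "c = real L * PW / real Lt"
  have c: "c > 0" using L PW by (simp add: c_def)
  have fin: "finite ((\<lambda>k. (cmod (h k))\<^sup>2) ` {..<K})" "(\<lambda>k. (cmod (h k))\<^sup>2) ` {..<K} \<noteq> {}"
    using K by (auto simp: lessThan_empty_iff)
  show pos: "hmin > 0" unfolding hmin_def using fin h by (subst Min_gr_iff) auto
  have "(\<forall>k<K. real L * P * PW / (real Lt * (cmod (h k))\<^sup>2) \<le> PX) \<longleftrightarrow> P \<le> PX * hmin / c"
    if P: "P > 0" for P
  proof -
    have eq: "real L * P * PW / (real Lt * (cmod (h k))\<^sup>2) \<le> PX \<longleftrightarrow> P * c \<le> PX * (cmod (h k))\<^sup>2"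
      if "k < K" for k
    proof -
      have "(cmod (h k))\<^sup>2 > 0" using h that by simp
      then show ?thesis using L by (simp add: c_def field_simps)
    qed
    have "(\<forall>k<K. P * c \<le> PX * (cmod (h k))\<^sup>2) \<longleftrightarrow> P * c \<le> PX * hmin"
    proof
      have "hmin \<in> (\<lambda>k. (cmod (h k))\<^sup>2) ` {..<K}" unfolding hmin_def by (rule Min_in[OF fin])
      then show "P * c \<le> PX * hmin" if "\<forall>k<K. P * c \<le> PX * (cmod (h k))\<^sup>2" using that by auto
      assume le: "P * c \<le> PX * hmin"
      \<comment> \<open>The sign of \<open>PX\<close>, used to multiply
        \<open>hmin \<le> (cmod (h k))^2\<close>, follows from the inequality itself, whose left
        side is positive.\<close>
      have "0 < PX * hmin" using le P c by (meson less_le_trans mult_pos_pos)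
      then have "PX > 0" using pos by (simp add: zero_less_mult_iff)
      show "\<forall>k<K. P * c \<le> PX * (cmod (h k))\<^sup>2"
      proof (intro allI impI)
        fix k assume "k < K"
        then have "hmin \<le> (cmod (h k))\<^sup>2" unfolding hmin_def using fin by (intro Min_le) auto
        then show "P * c \<le> PX * (cmod (h k))\<^sup>2"
          using le \<open>PX > 0\<close> by (meson mult_left_mono less_imp_le order_trans)
      qed
    qed
    then show ?thesis using eq c by (simp add: field_simps)
  qed
  then show "feasible K L Lt h PW PX \<Phi> P \<longleftrightarrow>
      P > 0 \<and> admissible_enc L Lt \<Phi> \<and> P \<le> PX * hmin / (real L / real Lt * PW)"
    unfolding feasible_def c_def by auto
qed

theorem theorem1:
  fixes M :: "'w measure"
    and K L Lt :: nat
    and h :: "nat \<Rightarrow> complex"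
    and PW PX N0 :: real
    and w :: "nat \<Rightarrow> 'w \<Rightarrow> nat \<Rightarrow> complex"
    and nz :: "'w \<Rightarrow> nat \<Rightarrow> complex"
  assumes "K \<ge> 1" and "1 \<le> L" and "L \<le> Lt"
    and "\<forall>k<K. h k \<noteq> 0"
    and "PW > 0" and "PX > 0" and "N0 > 0"
    and "ota_model M K L Lt PW N0 w nz"
  defines "R \<equiv> real L / real Lt"
    and "\<rho> \<equiv> PX / N0"
    and "hmin \<equiv> Min ((\<lambda>k. (cmod (h k))\<^sup>2) ` {..<K})"
  shows "(\<forall>\<Phi> P. optimal M K L Lt h PW PX w nz \<Phi> P \<longleftrightarrow>
            (P = PX * hmin / (R * PW) \<and> admissible_enc L Lt \<Phi> \<and> mat_adjoint \<Phi> * \<Phi> = 1\<^sub>m L))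
       \<and> (\<exists>\<Phi> P. feasible K L Lt h PW PX \<Phi> P \<and>
            comp_error M K L Lt h w nz \<Phi> P = R * PW / (\<rho> * hmin))
       \<and> (\<forall>\<Phi> P. feasible K L Lt h PW PX \<Phi> P \<longrightarrow>
            R * PW / (\<rho> * hmin) \<le> comp_error M K L Lt h w nz \<Phi> P)
       \<and> (\<forall>\<Phi> P. optimal M K L Lt h PW PX w nz \<Phi> P \<longrightarrow>
            distributed M lborel (ota_dist K L Lt h w nz \<Phi> P)
              (\<lambda>x. ennreal (gamma_density (real L) (PW / (real Lt * \<rho> * hmin)) x)))"
proof -
  have M: "prob_space M" and nz: "cn_vec M Lt N0 nz"
    using assms(8) by (auto simp: ota_model_def)
  interpret prob_space M by fact
  note K = assms(1) and L = assms(2,3) and h = assms(4) and PW = assms(5) and PX = assms(6) and N0 = assms(7)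
  have Lp: "real L > 0" "real Lt > 0" using L by auto
  \<comment> \<open>The largest feasible power; by \<open>opt\<close> below, the claimed minimum is
    \<open>N0 / Ps\<close>.\<close>
  define Ps where "Ps = PX * hmin / (R * PW)"
  note fe = feasible_iff(1)[OF K L h PW, of PX, folded hmin_def, folded R_def, folded Ps_def]
  have hm: "hmin > 0" using feasible_iff(2)[OF K L h PW] by (simp add: hmin_def)
  have R: "R > 0" using Lp by (simp add: R_def)
  have Ps: "Ps > 0" using hm R PW PX by (simp add: Ps_def)
  have opt: "R * PW / (\<rho> * hmin) = N0 / Ps" using N0 PX hm by (simp add: \<rho>_def Ps_def)
  define F where "F \<Phi> = (\<Sum>i<L. \<Sum>j<Lt. (cmod (mp_pinv \<Phi> $$ (i, j)))\<^sup>2)" for \<Phi>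
  have ce: "comp_error M K L Lt h w nz \<Phi> P = N0 / P * (F \<Phi> / real L)"
    if "admissible_enc L Lt \<Phi>" "P > 0" for \<Phi> P
    using comp_error_eq[OF that(1) L(2) that(2) h M nz N0] by (simp add: F_def mult_ac)
  have F_ge: "real L \<le> F \<Phi>" if "admissible_enc L Lt \<Phi>" for \<Phi>
    using frobenius_left_inverse_ge[OF _ admissible_enc_pinv[OF that L(2)]] that
    by (simp add: F_def admissible_enc_def)
  have F_eq: "F \<Phi> = real L \<longleftrightarrow> mat_adjoint \<Phi> * \<Phi> = 1\<^sub>m L" if adm: "admissible_enc L Lt \<Phi>" for \<Phi>
  proof
    have \<Phi>: "\<Phi> \<in> carrier_mat Lt L" and tr: "mat_tr (mat_adjoint \<Phi> * \<Phi>) = of_nat L"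
      using adm by (auto simp: admissible_enc_def)
    note X = admissible_enc_pinv[OF adm L(2)]
    show "mat_adjoint \<Phi> * \<Phi> = 1\<^sub>m L" if "F \<Phi> = real L"
      using frobenius_left_inverse_eqD[OF \<Phi> X tr] that by (simp add: F_def)
    assume "mat_adjoint \<Phi> * \<Phi> = 1\<^sub>m L"
    then have "mp_pinv \<Phi> = mat_adjoint \<Phi>" by (rule mp_pinv_of_isometry[OF \<Phi>])
    then show "F \<Phi> = real L"
      using frobenius_left_inverse[OF \<Phi> X tr] \<Phi> by (simp add: F_def)
  qed
  \<comment> \<open>The bound joins two estimates, \<open>P \<le> Ps\<close> and
    \<open>F \<Phi> \<ge> L\<close>. Equality in the product forces equality in both, which pins
    down \<open>P\<close> and \<open>\<Phi>\<close> separately.\<close>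
  have lower: "N0 / Ps \<le> comp_error M K L Lt h w nz \<Phi> P"
    and lower_eq: "comp_error M K L Lt h w nz \<Phi> P = N0 / Ps \<Longrightarrow>
      P = Ps \<and> mat_adjoint \<Phi> * \<Phi> = 1\<^sub>m L"
    if "feasible K L Lt h PW PX \<Phi> P" for \<Phi> P
  proof -
    have P: "P > 0" "P \<le> Ps" and adm: "admissible_enc L Lt \<Phi>" using that by (auto simp: fe)
    have 1: "N0 / Ps \<le> N0 / P" using P N0 by (simp add: frac_le)
    have 2: "N0 / P * 1 \<le> N0 / P * (F \<Phi> / real L)"
      using F_ge[OF adm] P N0 Lp by (intro mult_left_mono) auto
    show "N0 / Ps \<le> comp_error M K L Lt h w nz \<Phi> P" using 1 2 unfolding ce[OF adm P(1)] by simp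
    assume "comp_error M K L Lt h w nz \<Phi> P = N0 / Ps"
    then have "N0 / Ps = N0 / P" "N0 / P * (F \<Phi> / real L) = N0 / P * 1"
      using 1 2 unfolding ce[OF adm P(1)] by auto
    then have "P = Ps" "F \<Phi> = real L" using N0 P Ps Lp by (auto simp: field_simps)
    then show "P = Ps \<and> mat_adjoint \<Phi> * \<Phi> = 1\<^sub>m L" using F_eq[OF adm] by simp
  qed
  have attain: "feasible K L Lt h PW PX \<Phi> Ps" "comp_error M K L Lt h w nz \<Phi> Ps = N0 / Ps"
    if "admissible_enc L Lt \<Phi>" "mat_adjoint \<Phi> * \<Phi> = 1\<^sub>m L" for \<Phi>
    using that Ps F_eq[of \<Phi>] Lp by (auto simp: fe ce)
  obtain \<Phi>0 where \<Phi>0: "admissible_enc L Lt \<Phi>0" "mat_adjoint \<Phi>0 * \<Phi>0 = 1\<^sub>m L"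
    using exists_admissible_isometry[OF L] by blast
  have main: "optimal M K L Lt h PW PX w nz \<Phi> P \<longleftrightarrow>
      P = Ps \<and> admissible_enc L Lt \<Phi> \<and> mat_adjoint \<Phi> * \<Phi> = 1\<^sub>m L" for \<Phi> P
  proof
    assume o: "optimal M K L Lt h PW PX w nz \<Phi> P"
    then have f: "feasible K L Lt h PW PX \<Phi> P" by (simp add: optimal_def)
    have "comp_error M K L Lt h w nz \<Phi> P \<le> N0 / Ps"
      using o attain[OF \<Phi>0] unfolding optimal_def by metis
    then have "comp_error M K L Lt h w nz \<Phi> P = N0 / Ps" using lower[OF f] by simp
    then show "P = Ps \<and> admissible_enc L Lt \<Phi> \<and> mat_adjoint \<Phi> * \<Phi> = 1\<^sub>m L"
      using lower_eq[OF f] f by (simp add: feasible_def)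
  next
    assume "P = Ps \<and> admissible_enc L Lt \<Phi> \<and> mat_adjoint \<Phi> * \<Phi> = 1\<^sub>m L"
    then show "optimal M K L Lt h PW PX w nz \<Phi> P"
      using attain[of \<Phi>] lower by (simp add: optimal_def)
  qed
  have gam: "distributed M lborel (ota_dist K L Lt h w nz \<Phi> P)
      (\<lambda>x. ennreal (gamma_density (real L) (PW / (real Lt * \<rho> * hmin)) x))"
    if "optimal M K L Lt h PW PX w nz \<Phi> P" for \<Phi> P
  proof -
    have P: "P = Ps" and adm: "admissible_enc L Lt \<Phi>" and iso: "mat_adjoint \<Phi> * \<Phi> = 1\<^sub>m L"
      using that by (auto simp: main)
    have \<Phi>: "\<Phi> \<in> carrier_mat Lt L" using adm by (simp add: admissible_enc_def)
    obtain k where k: "L = Suc k" using L by (cases L) auto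
    define c where "c = 1 / (real L * P)"
    have c: "c > 0" using Lp Ps P by (simp add: c_def)
    \<comment> \<open>With \<open>P = Ps\<close> the scale is \<open>N0 / (L * Ps)\<close>, and
      \<open>R / L = 1 / Lt\<close> turns it into the stated form.\<close>
    have th: "PW / (real Lt * \<rho> * hmin) = N0 * c" "N0 * c > 0"
      using N0 PX hm Lp PW c by (auto simp: c_def P Ps_def \<rho>_def R_def mult_ac)
    have "ota_dist K L Lt h w nz \<Phi> P \<omega> = c * (\<Sum>i<L. (cmod (\<Sum>j<Lt. cnj (\<Phi> $$ (j, i)) * nz \<omega> j))\<^sup>2)" for \<omega>
      unfolding ota_dist_eq[OF adm L(2) Ps h, folded P] c_def mp_pinv_of_isometry[OF \<Phi> iso]
      using \<Phi> by simp
    then have "distributed M lborel (ota_dist K L Lt h w nz \<Phi> P) (erlang_density k (1 / (N0 * c)))"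
      using cn_vec_isometry_erlang[OF nz N0 \<Phi>[unfolded k] iso[unfolded k] c]
      unfolding k by presburger
    \<comment> \<open>The densities agree away from the null set \<open>{0}\<close>, which suffices
      for the law.\<close>
    moreover have "AE x in lborel. ennreal (erlang_density k (1 / (N0 * c)) x) =
        ennreal (gamma_density (real L) (PW / (real Lt * \<rho> * hmin)) x)"
      using AE_lborel_singleton[of "0::real"]
      by eventually_elim (simp add: th(1) k gamma_density_eq_erlang[OF _ th(2)] del: of_nat_Suc)
    moreover have "(\<lambda>x. ennreal (gamma_density (real L) (PW / (real Lt * \<rho> * hmin)) x)) \<in> borel_measurable lborel"
      unfolding gamma_density_def by measurable
    ultimately show ?thesis
      unfolding distributed_def by (simp cong: density_cong)
  qed
  show ?thesis
    unfolding Ps_def[symmetric] opt using main attain[OF \<Phi>0] lower gam by blast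
qed

end
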